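(* Let $t\in\mathbb R$ and let $\Phi:\mathcal B(L^2(B))\to B\otimes B^{\mathrm{op}}$ be either $\Psi_{t,t}$ or $\Psi'_{t,t}$. Let $B\subseteq\mathcal B(H)$ with $H$ a finite-dimensional Hilbert space. Then $A\mapsto e=\Phi(A)$, $e\mapsto(V,W)=(\mathrm{Im}(e),\ker(e))$ (with $e$ acting on $H\otimes\overline H$), and the identification $\mathcal B(H)\cong H\otimes\overline H$ give bijections between: (1) self-adjoint $A\in\mathcal B(L^2(B))$ satisfying $m(A\otimes A)m^*=A$; (2) idempotents $e\in B\otimes B^{\mathrm{op}}$ (i.e. $e^2=e$) with $e=\sigma(e^* )$; (3) (not necessarily orthogonal) direct sum decompositions $H\otimes\overline H=V\oplus W$ with $V,W$ being $B'\otimes(B')^{\mathrm{op}}$-invariant, and $J_0(V)=V$, $J_0(W)=W$; (4) (not necessarily orthogonal) direct sum decompositions $\mathcal B(H)=V\oplus W$ with $V,W$ self-adjoint $B'$-bimodules.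
   Context: $B$ is a finite-dimensional $C^*$-algebra, $\mathrm{Tr}$ the sum of the non-normalised traces of its matrix blocks, $\psi$ a faithful state on $B$, $Q\in B$ the positive invertible element with $\psi(a)=\mathrm{Tr}(Qa)$, and $\sigma_z(a)=Q^{iz}aQ^{-iz}$ for $z\in\mathbb C$, $a\in B$. Inner products are linear in the right variable and $\theta_{\xi,\eta}(\zeta)=(\xi|\zeta)\eta$. $L^2(B)$ is the GNS space of $\psi$ with GNS map $\Lambda$ (a linear bijection), $(\Lambda(a)|\Lambda(b))=\psi(a^*b)$; $m(\Lambda(a)\otimes\Lambda(b))=\Lambda(ab)$ with Hilbert space adjoint $m^*$. $B^{\mathrm{op}}$ is $B$ with the same $*$-vector space structure and reversed product; $\sigma:a\otimes b\mapsto b\otimes a$ is the swap on $B\otimes B^{\mathrm{op}}$. For $s,t\in\mathbb R$, $\Psi_{t,s}$ and $\Psi'_{t,s}$ are the linear bijections $\mathcal B(L^2(B))\to B\otimes B^{\mathrm{op}}$ determined by $\Psi_{t,s}(\theta_{\Lambda(a),\Lambda(b)})=\sigma_{it}(a)^*\otimes\sigma_{is}(b)$ and $\Psi'_{t,s}(\theta_{\Lambda(a),\Lambda(b)})=\sigma_{it}(b)\otimes\sigma_{is}(a)^*$. $B$ is a unital $*$-subalgebra of $\mathcal B(H)$ with commutant $B'$. $\overline H$ is the conjugate Hilbert space; $x^\top(\overline\xi)=\overline{x^*\xi}$ for $x\in\mathcal B(H)$; $B\otimes B^{\mathrm{op}}$, and likewise $B'\otimes(B')^{\mathrm{op}}$,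 act on $H\otimes\overline H$ via $a\otimes b\mapsto a\otimes b^\top$; $\mathcal B(H)\cong H\otimes\overline H$ via $\theta_{\xi,\eta}\mapsto\eta\otimes\overline\xi$; $J_0$ is the antilinear map with $J_0(\eta\otimes\overline\xi)=\xi\otimes\overline\eta$. A $B'$-bimodule is a subspace $V\subseteq\mathcal B(H)$ with $xvy\in V$ for $x,y\in B'$, $v\in V$; self-adjoint means $V^*=V$. *)

theory Defs
  imports "HOL-Analysis.Analysis"
begin

text \<open>
  Finite-dimensional Hilbert spaces are coordinate spaces \<open>complex^'k\<close> with the standard inner
  product, and their bounded operators are square matrices.  Tensor products are coordinate spaces
  over product index types, with elementary tensors given by Kronecker products.
\<close>

section \<open>Complex vectors and matrices\<close>

text \<open>Linear in the right variable.\<close>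

definition cinner :: "complex^'k \<Rightarrow> complex^'k \<Rightarrow> complex" where
  "cinner \<xi> \<eta> = (\<Sum>i\<in>UNIV. cnj (\<xi> $ i) * \<eta> $ i)"

definition adj :: "complex^'k^'l \<Rightarrow> complex^'l^'k" where
  "adj x = (\<chi> i j. cnj (x $ j $ i))"

lemma cinner_adj: "cinner \<xi> (x *v \<eta>) = cinner (adj x *v \<xi>) \<eta>"
  unfolding cinner_def adj_def matrix_vector_mult_def
  by (simp add: sum_distrib_left sum_distrib_right ac_simps) (rule sum.swap)

text \<open>The library's \<open>(*s)\<close> scales \<open>complex^'k\<close>; on matrices it would take row vectors as scalars.\<close>

definition cscale :: "complex \<Rightarrow> complex^'k^'l \<Rightarrow> complex^'k^'l" where
  "cscale c x = (\<chi> i j. c * x $ i $ j)"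

interpretation mat: vector_space "cscale :: complex \<Rightarrow> complex^'k^'l \<Rightarrow> complex^'k^'l"
  by unfold_locales (simp_all add: cscale_def vec_eq_iff algebra_simps)

definition theta :: "complex^'k \<Rightarrow> complex^'l \<Rightarrow> complex^'k^'l" where
  "theta \<xi> \<eta> = (\<chi> i j. \<eta> $ i * cnj (\<xi> $ j))"

lemma theta_apply: "theta \<xi> \<eta> *v \<zeta> = cinner \<xi> \<zeta> *s \<eta>"
  by (simp add: theta_def cinner_def matrix_vector_mult_def vec_eq_iff sum_distrib_right
      sum_distrib_left ac_simps)

definition positive_mat :: "complex^'k^'k \<Rightarrow> bool" where
  "positive_mat x \<longleftrightarrow> (\<forall>\<xi>. cinner \<xi> (x *v \<xi>) \<in> \<real>\<^sub>\<ge>\<^sub>0)"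

definition unitary_mat :: "complex^'k^'k \<Rightarrow> bool" where
  "unitary_mat u \<longleftrightarrow> adj u ** u = mat 1 \<and> u ** adj u = mat 1"

definition diag_mat :: "('k \<Rightarrow> complex) \<Rightarrow> complex^'k^'k" where
  "diag_mat d = (\<chi> i j. if i = j then d i else 0)"

text \<open>Functional calculus: the power \<open>Q\<^sup>w\<close> of a positive invertible matrix, by unitary
  diagonalisation.\<close>

definition cpow :: "complex^'k^'k \<Rightarrow> complex \<Rightarrow> complex^'k^'k" where
  "cpow Q w = (THE x. \<exists>u (d :: 'k \<Rightarrow> real). unitary_mat u \<and> (\<forall>i. 0 < d i) \<and>
      Q = u ** diag_mat (\<lambda>i. of_real (d i)) ** adj u \<and>
      x = u ** diag_mat (\<lambda>i. of_real (d i) powr w) ** adj u)"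

lemma cpow_unitary_diag:
  fixes d :: "'k::finite \<Rightarrow> real"
  assumes u: "unitary_mat u" and d: "\<forall>i. 0 < d i"
  shows "cpow (u ** diag_mat (\<lambda>i. of_real (d i)) ** adj u) w =
    u ** diag_mat (\<lambda>i. of_real (d i) powr w) ** adj u"
  unfolding cpow_def
proof (rule the_equality, use u d in blast)
  fix x
  assume "\<exists>v (e :: 'k \<Rightarrow> real). unitary_mat v \<and> (\<forall>i. 0 < e i) \<and>
      u ** diag_mat (\<lambda>i. of_real (d i)) ** adj u = v ** diag_mat (\<lambda>i. of_real (e i)) ** adj v \<and>
      x = v ** diag_mat (\<lambda>i. of_real (e i) powr w) ** adj v"
  then obtain v and e :: "'k \<Rightarrow> real" where v: "unitary_mat v"
    and eq: "u ** diag_mat (\<lambda>i. of_real (d i)) ** adj u = v ** diag_mat (\<lambda>i. of_real (e i)) ** adj v"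
    and x: "x = v ** diag_mat (\<lambda>i. of_real (e i) powr w) ** adj v" by blast
  have uu: "adj u ** u = mat 1" "u ** adj u = mat 1" and vv: "adj v ** v = mat 1" "v ** adj v = mat 1"
    using u v by (auto simp: unitary_mat_def)
  have left: "(diag_mat f ** y) $ i $ j = f i * y $ i $ j" for f and y :: "complex^'k^'k" and i j
    by (simp add: diag_mat_def matrix_matrix_mult_def if_distrib[of "\<lambda>z. z * _"] cong: if_cong)
  have right: "(y ** diag_mat f) $ i $ j = y $ i $ j * f j" for f and y :: "complex^'k^'k" and i j
    by (simp add: diag_mat_def matrix_matrix_mult_def if_distrib[of "\<lambda>z. _ * z"] cong: if_cong)
  define c where "c = adj v ** u"
  have "adj v ** (v ** diag_mat (\<lambda>i. of_real (e i)) ** adj v) ** u =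
        adj v ** (u ** diag_mat (\<lambda>i. of_real (d i)) ** adj u) ** u"
    using eq by simp
  then have "(adj v ** v) ** diag_mat (\<lambda>i. of_real (e i)) ** (adj v ** u) =
        (adj v ** u) ** diag_mat (\<lambda>i. of_real (d i)) ** (adj u ** u)"
    by (simp only: matrix_mul_assoc)
  then have "diag_mat (\<lambda>i. of_real (e i)) ** c = c ** diag_mat (\<lambda>i. of_real (d i))"
    by (simp add: uu vv c_def)
  then have "of_real (e i) * c $ i $ j = c $ i $ j * of_real (d j)" for i j
    by (metis left right)
  then have "c $ i $ j = 0 \<or> e i = d j" for i j
    by (metis mult.commute mult_cancel_left of_real_eq_iff)
  then have "of_real (e i) powr w * c $ i $ j = c $ i $ j * of_real (d j) powr w" for i j
    by (metis mult.commute mult_zero_left)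
  then have c: "diag_mat (\<lambda>i. of_real (e i) powr w) ** c = c ** diag_mat (\<lambda>i. of_real (d i) powr w)"
    by (simp add: vec_eq_iff left right)
  have "x = v ** diag_mat (\<lambda>i. of_real (e i) powr w) ** adj v ** (u ** adj u)"
    by (simp add: x uu)
  also have "\<dots> = v ** (diag_mat (\<lambda>i. of_real (e i) powr w) ** c) ** adj u"
    by (simp add: c_def matrix_mul_assoc)
  also have "\<dots> = (v ** adj v) ** u ** diag_mat (\<lambda>i. of_real (d i) powr w) ** adj u"
    unfolding c by (simp add: c_def matrix_mul_assoc)
  finally show "x = u ** diag_mat (\<lambda>i. of_real (d i) powr w) ** adj u"
    by (simp add: vv)
qed

section \<open>Tensor products\<close>

definition vtensor :: "complex^'k \<Rightarrow> complex^'l \<Rightarrow> complex^('k \<times> 'l)" where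
  "vtensor \<xi> \<eta> = (\<chi> p. \<xi> $ fst p * \<eta> $ snd p)"

definition kron :: "complex^'k^'l \<Rightarrow> complex^'k2^'l2 \<Rightarrow> complex^('k \<times> 'k2)^('l \<times> 'l2)" where
  "kron x y = (\<chi> p q. x $ fst p $ fst q * y $ snd p $ snd q)"

lemma kron_vtensor: "kron x y *v vtensor \<xi> \<eta> = vtensor (x *v \<xi>) (y *v \<eta>)"
  by (simp add: vec_eq_iff kron_def vtensor_def matrix_vector_mult_def sum_product
      sum.cartesian_product case_prod_unfold ac_simps flip: UNIV_Times_UNIV)

lemma adj_kron: "adj (kron x y) = kron (adj x) (adj y)"
  by (simp add: vec_eq_iff adj_def kron_def)

text \<open>\<open>tensor_alg B C\<close> is the underlying \<open>*\<close>-vector space of both \<open>B \<otimes> C\<close> and \<open>B \<otimes> C\<^sup>o\<^sup>p\<close>,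
  with involution \<open>adj\<close>.\<close>

definition tensor_alg ::
    "(complex^'k^'k) set \<Rightarrow> (complex^'l^'l) set \<Rightarrow> (complex^('k \<times> 'l)^('k \<times> 'l)) set" where
  "tensor_alg B C = mat.span {kron b c | b c. b \<in> B \<and> c \<in> C}"

text \<open>The product of \<open>B \<otimes> B\<^sup>o\<^sup>p\<close>, which reverses the multiplication in the second leg.\<close>

definition op_mult :: "complex^('k::finite \<times> 'l::finite)^('k \<times> 'l) \<Rightarrow> complex^('k \<times> 'l)^('k \<times> 'l) \<Rightarrow>
    complex^('k \<times> 'l)^('k \<times> 'l)" where
  "op_mult x y = (\<chi> p q. \<Sum>r\<in>UNIV. \<Sum>s\<in>UNIV.
      x $ (fst p, s) $ (r, snd q) * y $ (r, snd p) $ (fst q, s))"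

lemma op_mult_kron: "op_mult (kron a b) (kron c d) = kron (a ** c) (d ** b)"
  by (simp add: vec_eq_iff op_mult_def kron_def matrix_matrix_mult_def sum_product ac_simps)

definition swap :: "complex^('k::finite \<times> 'k)^('k \<times> 'k) \<Rightarrow> complex^('k \<times> 'k)^('k \<times> 'k)" where
  "swap x = (\<chi> p q. x $ (snd p, fst p) $ (snd q, fst q))"

lemma swap_kron: "swap (kron a b) = kron b a"
  by (simp add: vec_eq_iff swap_def kron_def)

section \<open>The conjugate Hilbert space\<close>

text \<open>The conjugate Hilbert space of \<open>complex^'k\<close> is modelled by \<open>complex^'k\<close> itself, with
  \<open>\<xi> \<mapsto> conj_vec \<xi>\<close> as the canonical antilinear map.  The operator \<open>x\<^sup>\<top>\<close> is then the matrix
  transpose.\<close>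

definition conj_vec :: "complex^'k \<Rightarrow> complex^'k" where
  "conj_vec \<xi> = (\<chi> i. cnj (\<xi> $ i))"

lemma conj_vec_scale: "conj_vec (c *s \<xi>) = cnj c *s conj_vec \<xi>"
  by (simp add: conj_vec_def vec_eq_iff)

lemma cinner_conj_vec: "cinner (conj_vec \<xi>) (conj_vec \<eta>) = cinner \<eta> \<xi>"
  by (simp add: conj_vec_def cinner_def ac_simps)

lemma transpose_conj_vec: "transpose x *v conj_vec \<xi> = conj_vec (adj x *v \<xi>)"
  by (simp add: conj_vec_def vec_eq_iff transpose_def adj_def matrix_vector_mult_def)

text \<open>The action \<open>a \<otimes> b \<mapsto> a \<otimes> b\<^sup>\<top>\<close> of \<open>B \<otimes> B\<^sup>o\<^sup>p\<close>, a partial transpose.\<close>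

definition act :: "complex^('k::finite \<times> 'l::finite)^('k \<times> 'l) \<Rightarrow> complex^('k \<times> 'l)^('k \<times> 'l)" where
  "act x = (\<chi> p q. x $ (fst p, snd q) $ (fst q, snd p))"

lemma act_kron: "act (kron a b) = kron a (transpose b)"
  by (simp add: vec_eq_iff act_def kron_def transpose_def)

lemma act_op_mult: "act (op_mult x y) = act x ** act y"
  by (simp add: vec_eq_iff act_def op_mult_def matrix_matrix_mult_def sum.cartesian_product
      case_prod_unfold flip: UNIV_Times_UNIV)

definition J0 :: "complex^('k::finite \<times> 'k) \<Rightarrow> complex^('k \<times> 'k)" where
  "J0 v = (\<chi> p. cnj (v $ (snd p, fst p)))"

lemma J0_vtensor: "J0 (vtensor \<eta> (conj_vec \<xi>)) = vtensor \<xi> (conj_vec \<eta>)"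
  by (simp add: vec_eq_iff J0_def vtensor_def conj_vec_def)

lemma J0_antilinear: "J0 (v + w) = J0 v + J0 w" "J0 (c *s v) = cnj c *s J0 v"
  by (simp_all add: vec_eq_iff J0_def)

text \<open>The identification of operators on \<open>H\<close> with vectors of \<open>H\<close> tensored with its conjugate.\<close>

definition hs :: "complex^'k^'k \<Rightarrow> complex^('k \<times> 'k)" where
  "hs x = (\<chi> p. x $ fst p $ snd p)"

lemma hs_theta: "hs (theta \<xi> \<eta>) = vtensor \<eta> (conj_vec \<xi>)"
  by (simp add: vec_eq_iff hs_def vtensor_def conj_vec_def theta_def)

section \<open>Operator algebras\<close>

definition star_subalgebra :: "(complex^'k^'k) set \<Rightarrow> bool" where
  "star_subalgebra B \<longleftrightarrow> mat.subspace B \<and> mat 1 \<in> B \<and>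
     (\<forall>a\<in>B. adj a \<in> B) \<and> (\<forall>a\<in>B. \<forall>b\<in>B. a ** b \<in> B)"

definition commutant :: "(complex^'k^'k) set \<Rightarrow> (complex^'k^'k) set" where
  "commutant B = {x. \<forall>b\<in>B. x ** b = b ** x}"

text \<open>A direct sum of full matrix algebras, one block for each fibre of \<open>blk\<close>, realised as block
  diagonal matrices.  The sum of the non-normalised traces of the blocks is then the matrix trace.\<close>

definition block_diagonal :: "('m \<Rightarrow> nat) \<Rightarrow> (complex^'m^'m) set" where
  "block_diagonal blk = {x. \<forall>i j. blk i \<noteq> blk j \<longrightarrow> x $ i $ j = 0}"

definition star_iso ::
    "(complex^'k^'k \<Rightarrow> complex^'m^'m) \<Rightarrow> (complex^'k^'k) set \<Rightarrow> (complex^'m^'m) set \<Rightarrow> bool" where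
  "star_iso \<phi> B C \<longleftrightarrow> bij_betw \<phi> B C \<and>
     (\<forall>a\<in>B. \<forall>b\<in>B. \<phi> (a + b) = \<phi> a + \<phi> b \<and> \<phi> (a ** b) = \<phi> a ** \<phi> b) \<and>
     (\<forall>a\<in>B. \<phi> (adj a) = adj (\<phi> a) \<and> (\<forall>c. \<phi> (cscale c a) = cscale c (\<phi> a)))"

definition faithful_state :: "(complex^'k^'k) set \<Rightarrow> (complex^'k^'k \<Rightarrow> complex) \<Rightarrow> bool" where
  "faithful_state B \<psi> \<longleftrightarrow>
     (\<forall>a\<in>B. \<forall>b\<in>B. \<psi> (a + b) = \<psi> a + \<psi> b) \<and> (\<forall>c. \<forall>a\<in>B. \<psi> (cscale c a) = c * \<psi> a) \<and>
     \<psi> (mat 1) = 1 \<and> (\<forall>a\<in>B. \<psi> (adj a ** a) \<in> \<real>\<^sub>\<ge>\<^sub>0) \<and> (\<forall>a\<in>B. \<psi> (adj a ** a) = 0 \<longrightarrow> a = 0)"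

definition modular :: "complex^'k^'k \<Rightarrow> complex \<Rightarrow> complex^'k^'k \<Rightarrow> complex^'k^'k" where
  "modular Q z a = cpow Q (\<i> * z) ** a ** cpow Q (- (\<i> * z))"

text \<open>The GNS space of \<open>\<psi>\<close> is \<open>complex^'d\<close>, via the GNS map \<open>\<Lambda>\<close>; so \<open>'d\<close> has as many elements as
  the dimension of \<open>B\<close>.\<close>

definition gns_map ::
    "(complex^'k^'k) set \<Rightarrow> (complex^'k^'k \<Rightarrow> complex) \<Rightarrow> (complex^'k^'k \<Rightarrow> complex^'d) \<Rightarrow> bool" where
  "gns_map B \<psi> \<Lambda> \<longleftrightarrow> bij_betw \<Lambda> B UNIV \<and>
     (\<forall>a\<in>B. \<forall>b\<in>B. \<Lambda> (a + b) = \<Lambda> a + \<Lambda> b) \<and> (\<forall>c. \<forall>a\<in>B. \<Lambda> (cscale c a) = c *s \<Lambda> a) \<and>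
     (\<forall>a\<in>B. \<forall>b\<in>B. cinner (\<Lambda> a) (\<Lambda> b) = \<psi> (adj a ** b))"

text \<open>The descriptions below determine their objects because the vectors \<open>\<Lambda> a\<close> exhaust
  \<open>complex^'d\<close>, so that the \<open>vtensor (\<Lambda> a) (\<Lambda> b)\<close> and the \<open>theta (\<Lambda> a) (\<Lambda> b)\<close> span.\<close>

definition gns_mult ::
    "(complex^'k^'k) set \<Rightarrow> (complex^'k^'k \<Rightarrow> complex^'d) \<Rightarrow> complex^('d \<times> 'd)^'d" where
  "gns_mult B \<Lambda> = (THE m. \<forall>a\<in>B. \<forall>b\<in>B. m *v vtensor (\<Lambda> a) (\<Lambda> b) = \<Lambda> (a ** b))"

definition Psi :: "(complex^'k^'k) set \<Rightarrow> complex^'k^'k \<Rightarrow> (complex^'k^'k \<Rightarrow> complex^'d) \<Rightarrow>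
    real \<Rightarrow> real \<Rightarrow> complex^'d^'d \<Rightarrow> complex^('k \<times> 'k)^('k \<times> 'k)" where
  "Psi B Q \<Lambda> t s = (THE \<Phi>. Vector_Spaces.linear cscale cscale \<Phi> \<and>
     (\<forall>a\<in>B. \<forall>b\<in>B. \<Phi> (theta (\<Lambda> a) (\<Lambda> b)) =
        kron (adj (modular Q (\<i> * of_real t) a)) (modular Q (\<i> * of_real s) b)))"

definition Psi' :: "(complex^'k^'k) set \<Rightarrow> complex^'k^'k \<Rightarrow> (complex^'k^'k \<Rightarrow> complex^'d) \<Rightarrow>
    real \<Rightarrow> real \<Rightarrow> complex^'d^'d \<Rightarrow> complex^('k \<times> 'k)^('k \<times> 'k)" where
  "Psi' B Q \<Lambda> t s = (THE \<Phi>. Vector_Spaces.linear cscale cscale \<Phi> \<and>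
     (\<forall>a\<in>B. \<forall>b\<in>B. \<Phi> (theta (\<Lambda> a) (\<Lambda> b)) =
        kron (modular Q (\<i> * of_real t) b) (adj (modular Q (\<i> * of_real s) a))))"

definition bimodule :: "(complex^'k^'k) set \<Rightarrow> (complex^'k^'k) set \<Rightarrow> bool" where
  "bimodule C V \<longleftrightarrow> mat.subspace V \<and> (\<forall>x\<in>C. \<forall>y\<in>C. \<forall>v\<in>V. x ** v ** y \<in> V)"

section \<open>The four sets of data\<close>

definition adjacency_ops :: "(complex^'k^'k) set \<Rightarrow> (complex^'k^'k \<Rightarrow> complex^'d) \<Rightarrow>
    (complex^'d^'d) set" where
  "adjacency_ops B \<Lambda> = {A. adj A = A \<and>
     gns_mult B \<Lambda> ** kron A A ** adj (gns_mult B \<Lambda>) = A}"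

definition swap_idempotents :: "(complex^'k^'k) set \<Rightarrow> (complex^('k \<times> 'k)^('k \<times> 'k)) set" where
  "swap_idempotents B = {e \<in> tensor_alg B B. op_mult e e = e \<and> e = swap (adj e)}"

definition invariant_decomps ::
    "(complex^'k^'k) set \<Rightarrow> ((complex^('k \<times> 'k)) set \<times> (complex^('k \<times> 'k)) set) set" where
  "invariant_decomps B = {(V, W). vec.subspace V \<and> vec.subspace W \<and>
     V \<inter> W = {0} \<and> {v + w | v w. v \<in> V \<and> w \<in> W} = UNIV \<and>
     (\<forall>x\<in>tensor_alg (commutant B) (commutant B).
        (\<forall>v\<in>V. act x *v v \<in> V) \<and> (\<forall>w\<in>W. act x *v w \<in> W)) \<and>
     J0 ` V = V \<and> J0 ` W = W}"

definition bimodule_decomps ::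
    "(complex^'k^'k) set \<Rightarrow> ((complex^'k^'k) set \<times> (complex^'k^'k) set) set" where
  "bimodule_decomps B = {(V, W). bimodule (commutant B) V \<and> bimodule (commutant B) W \<and>
     V \<inter> W = {0} \<and> {v + w | v w. v \<in> V \<and> w \<in> W} = UNIV \<and>
     adj ` V = V \<and> adj ` W = W}"

definition im_ker :: "complex^('k::finite \<times> 'k)^('k \<times> 'k) \<Rightarrow>
    (complex^('k \<times> 'k)) set \<times> (complex^('k \<times> 'k)) set" where
  "im_ker e = (range (\<lambda>v. act e *v v), {v. act e *v v = 0})"

end

theory Submission
  imports Defs
begin

text \<open>
  Let \<open>s \<xi>\<close> be \<open>\<sigma>\<^bsub>it\<^esub>(a)\<close> for \<open>\<xi> = \<Lambda>(a)\<close>; because \<open>\<sigma>\<^bsub>it\<^esub>\<close> is an automorphism of the algebra \<open>B\<close>, \<open>s\<close>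
  turns \<open>m\<close> into the product of \<open>B\<close>.  Since \<open>m(\<theta>\<^bsub>\<xi>,\<eta>\<^esub> \<otimes> \<theta>\<^bsub>\<xi>',\<eta>'\<^esub>)m\<^sup>* = \<theta>\<^bsub>m(\<xi>\<otimes>\<xi>'), m(\<eta>\<otimes>\<eta>')\<^esub>\<close>, the map
  \<open>\<Psi>\<close>, which is \<open>\<theta>\<^bsub>\<xi>,\<eta>\<^esub> \<mapsto> s(\<xi>)\<^sup>* \<otimes> s(\<eta>)\<close>, is an antihomomorphism from the Schur product to
  \<open>B \<otimes> B\<^sup>o\<^sup>p\<close> and carries the adjoint to \<open>e \<mapsto> \<sigma>(e\<^sup>*)\<close>; moreover
  \<open>\<Psi>' = \<sigma> \<circ> \<Psi>\<close>.  That \<open>\<sigma>\<^bsub>it\<^esub>\<close> preserves \<open>B\<close> follows from the double commutant theorem: powers of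
  \<open>Q\<close> commute with everything that commutes with \<open>Q\<close>.

  Idempotents in \<open>B \<otimes> B\<^sup>o\<^sup>p\<close> commute with \<open>B' \<otimes> (B')\<^sup>o\<^sup>p\<close>, which gives invariance of image and kernel.
  Conversely, the projection along an invariant decomposition commutes with \<open>x \<otimes> 1\<close> and \<open>1 \<otimes> x\<close> for
  \<open>x \<in> B'\<close>, so its slices in both tensor legs lie in \<open>B'' = B\<close>, which forces it into \<open>B \<otimes> B\<^sup>o\<^sup>p\<close>.
\<close>

section \<open>The inner product\<close>

lemma cinner_zero [simp]: "cinner 0 z = 0" "cinner z 0 = 0"
  by (simp_all add: cinner_def)

lemma cinner_add_left: "cinner (x + y) z = cinner x z + cinner y z"
  by (simp add: cinner_def distrib_right sum.distrib)

lemma cinner_add_right: "cinner x (y + z) = cinner x y + cinner x z"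
  by (simp add: cinner_def distrib_left sum.distrib)

lemma cinner_diff_right: "cinner x (y - z) = cinner x y - cinner x z"
  by (simp add: cinner_def right_diff_distrib sum_subtractf)

lemma cinner_scale_left: "cinner (c *s x) z = cnj c * cinner x z"
  by (simp add: cinner_def sum_distrib_left mult.assoc)

lemma cinner_scale_right: "cinner x (c *s z) = c * cinner x z"
  by (simp add: cinner_def sum_distrib_left mult.left_commute)

lemma cinner_commute: "cinner y x = cnj (cinner x y)"
  by (simp add: cinner_def mult.commute)

lemma cinner_sum_right: "cinner x (\<Sum>i\<in>I. f i) = (\<Sum>i\<in>I. cinner x (f i))"
  by (induction I rule: infinite_finite_induct) (simp_all add: cinner_add_right)

text \<open>The bridge to the real Euclidean structure, which supplies norms and the maximisation
  over a unit sphere in the spectral theorem.\<close>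

lemma inner_eq_Re_cinner: "x \<bullet> y = Re (cinner x y)" for x y :: "complex^'k"
  by (simp add: inner_vec_def cinner_def inner_complex_def)

lemma cinner_self: "cinner x x = of_real ((norm x)\<^sup>2)"
proof (rule complex_eqI)
  show "Re (cinner x x) = Re (of_real ((norm x)\<^sup>2))"
    by (simp add: power2_norm_eq_inner inner_eq_Re_cinner)
  show "Im (cinner x x) = Im (of_real ((norm x)\<^sup>2))"
    by (simp add: cinner_def)
qed

lemma cinner_self_eq_0_iff [simp]: "cinner x x = 0 \<longleftrightarrow> x = 0"
  by (simp add: cinner_self)

lemma adj_adj [simp]: "adj (adj x) = x"
  by (simp add: adj_def vec_eq_iff)

lemma cinner_matrix_ext:
  assumes "\<And>\<xi> \<eta>. cinner \<xi> (x *v \<eta>) = cinner \<xi> (y *v \<eta>)"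
  shows "x = y"
proof -
  have "cinner (x *v \<eta> - y *v \<eta>) (x *v \<eta> - y *v \<eta>) = 0" for \<eta>
    by (simp only: cinner_diff_right assms diff_self)
  then have "x *v \<eta> = y *v \<eta>" for \<eta> by simp
  then show ?thesis by (simp add: matrix_eq)
qed

text \<open>\<open>positive_mat\<close> constrains only the quadratic form, so self-adjointness has
  to be derived. The sesquilinear form \<open>D\<close> measures the failure of \<open>x\<close> to
  be self-adjoint; it vanishes on the diagonal because the quadratic form is real, and polarisation
  makes it vanish everywhere.\<close>

lemma positive_mat_adj:
  assumes "positive_mat x"
  shows "adj x = x"
proof (rule cinner_matrix_ext)
  define D where "D \<xi> \<eta> = cinner \<xi> (x *v \<eta>) - cnj (cinner \<eta> (x *v \<xi>))" for \<xi> \<eta>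
  have D0: "D \<xi> \<xi> = 0" for \<xi>
    using assms by (simp add: D_def positive_mat_def complex_nonneg_Reals_iff complex_eq_iff)
  have D_add: "D (\<xi> + \<eta>) (\<xi> + \<eta>) = D \<xi> \<xi> + D \<xi> \<eta> + D \<eta> \<xi> + D \<eta> \<eta>" for \<xi> \<eta>
    by (simp add: D_def cinner_add_left cinner_add_right matrix_vector_right_distrib)
  have D_sc: "D \<xi> (c *s \<eta>) = c * D \<xi> \<eta>" "D (c *s \<xi>) \<eta> = cnj c * D \<xi> \<eta>" for \<xi> \<eta> c
    by (simp_all add: D_def cinner_scale_left cinner_scale_right vector_scalar_commute algebra_simps)
  have 1: "D \<xi> \<eta> = - D \<eta> \<xi>" for \<xi> \<eta>
    using D_add[of \<xi> \<eta>] by (simp add: D0 eq_neg_iff_add_eq_0)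
  \<comment> \<open>Rotating one argument by \<open>\<i>\<close> turns the antisymmetry into
    symmetry, because \<open>D\<close> is antilinear on the left and linear on the right.\<close>
  have "\<i> * D \<xi> \<eta> = \<i> * D \<eta> \<xi>" for \<xi> \<eta>
    using 1[of \<xi> "\<i> *s \<eta>"] by (simp add: D_sc)
  then have "D \<xi> \<eta> = D \<eta> \<xi>" for \<xi> \<eta> by simp
  with 1 have "D \<xi> \<eta> = - D \<xi> \<eta>" for \<xi> \<eta> by simp
  then have D: "D \<xi> \<eta> = 0" for \<xi> \<eta> by (simp add: eq_neg_iff_add_eq_0 flip: mult_2)
  show "cinner \<xi> (adj x *v \<eta>) = cinner \<xi> (x *v \<eta>)" for \<xi> \<eta>
    using D[of \<xi> \<eta>] cinner_adj[of \<xi> "adj x" \<eta>]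
    by (simp add: D_def flip: cinner_commute)
qed

section \<open>The spectral theorem\<close>

text \<open>A maximiser of the quadratic form of \<open>A\<close> on the compact unit sphere of
  \<open>S\<close> is an eigenvector: otherwise, moving towards the residual \<open>\<zeta>\<close>
  would increase the Rayleigh quotient to first order.\<close>

lemma hermitian_eigenvector_in_subspace:
  fixes A :: "complex^'k^'k"
  assumes A: "adj A = A"
    and S: "vec.subspace S" and inv: "\<And>\<xi>. \<xi> \<in> S \<Longrightarrow> A *v \<xi> \<in> S" and ne: "S \<noteq> {0}"
  obtains \<xi> :: "complex^'k" and \<mu> :: real where "\<xi> \<in> S" "norm \<xi> = 1" "A *v \<xi> = of_real \<mu> *s \<xi>"
proof -
  have scR: "r *\<^sub>R \<xi> = of_real r *s \<xi>" for r and \<xi> :: "complex^'k"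
    by (simp add: vec_eq_iff complex_eq_iff)
  have Ssc: "c *s \<xi> \<in> S" if "\<xi> \<in> S" for \<xi> c
    using S that by (rule vec.subspace_scale)
  have subsp: "subspace S"
    unfolding subspace_def scR using S by (simp add: vec.subspace_def)
  have comp: "compact (sphere 0 1 \<inter> S)"
    using closed_subspace[OF subsp] by (simp add: compact_Int_closed)
  obtain v where v: "v \<in> S" "v \<noteq> 0" using ne S vec.subspace_0 by blast
  then have "(1 / norm v) *\<^sub>R v \<in> sphere 0 1 \<inter> S" by (simp add: subspace_scale subsp)
  then have ne': "sphere 0 1 \<inter> S \<noteq> {}" by blast
  have cont: "continuous_on (sphere 0 1 \<inter> S) (\<lambda>\<xi>. \<xi> \<bullet> (A *v \<xi>))"
    by (intro continuous_intros linear_continuous_on matrix_vector_mul_bounded_linear)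
  obtain \<xi> where \<xi>: "\<xi> \<in> S" "norm \<xi> = 1"
    and max: "\<And>\<eta>. \<eta> \<in> S \<Longrightarrow> norm \<eta> = 1 \<Longrightarrow> \<eta> \<bullet> (A *v \<eta>) \<le> \<xi> \<bullet> (A *v \<xi>)"
    using continuous_attains_sup[OF comp ne' cont] by auto
  define \<mu> where "\<mu> = \<xi> \<bullet> (A *v \<xi>)"
  have linsc: "A *v (r *\<^sub>R \<zeta>) = r *\<^sub>R (A *v \<zeta>)" for r \<zeta>
    by (simp add: scR vector_scalar_commute)
  have lin: "A *v (\<eta> + r *\<^sub>R \<zeta>) = A *v \<eta> + r *\<^sub>R (A *v \<zeta>)" for r \<eta> \<zeta>
    by (simp add: matrix_vector_right_distrib linsc)
  \<comment> \<open>Homogeneity removes the normalisation, so that unnormalised perturbations of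
    \<open>\<xi>\<close> may be inserted.\<close>
  have max': "\<eta> \<bullet> (A *v \<eta>) \<le> \<mu> * (\<eta> \<bullet> \<eta>)" if "\<eta> \<in> S" for \<eta>
  proof (cases "\<eta> = 0")
    case False
    let ?\<zeta> = "(1 / norm \<eta>) *\<^sub>R \<eta>"
    have "?\<zeta> \<bullet> (A *v ?\<zeta>) \<le> \<mu>"
      unfolding \<mu>_def using that False by (intro max) (simp_all add: subspace_scale subsp)
    moreover have "A *v ?\<zeta> = (1 / norm \<eta>) *\<^sub>R (A *v \<eta>)"
      by (rule linsc)
    ultimately have "(\<eta> \<bullet> (A *v \<eta>)) / (norm \<eta> * norm \<eta>) \<le> \<mu>" by simp
    then show ?thesis
      using False by (simp add: divide_le_eq power2_norm_eq_inner[symmetric] power2_eq_square split: if_splits)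
  qed simp
  have herm: "\<eta> \<bullet> (A *v \<zeta>) = \<zeta> \<bullet> (A *v \<eta>)" for \<eta> \<zeta>
    by (simp add: inner_eq_Re_cinner cinner_adj[of \<eta>] A cinner_commute[of \<zeta>])
  define \<zeta> where "\<zeta> = A *v \<xi> - \<mu> *\<^sub>R \<xi>"
  have \<zeta>S: "\<zeta> \<in> S" unfolding \<zeta>_def using subsp \<xi> inv by (auto intro: subspace_diff subspace_scale)
  have n1: "\<xi> \<bullet> \<xi> = 1" using \<xi> by (simp add: power2_norm_eq_inner[symmetric])
  define c where "c = \<mu> * (\<zeta> \<bullet> \<zeta>) - \<zeta> \<bullet> (A *v \<zeta>)"
  have c0: "c \<ge> 0" using max'[OF \<zeta>S] by (simp add: c_def)
  \<comment> \<open>This compares \<open>\<xi> + r\<zeta>\<close> with the bound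
    \<open>max'\<close>; the constant terms cancel, a term linear in \<open>r\<close> with
    coefficient the squared norm of \<open>\<zeta>\<close> remains on the left, and the right side
    is quadratic.\<close>
  have q: "2 * r * (\<zeta> \<bullet> \<zeta>) \<le> r\<^sup>2 * c" for r
  proof -
    have "(\<xi> + r *\<^sub>R \<zeta>) \<bullet> (A *v (\<xi> + r *\<^sub>R \<zeta>)) \<le> \<mu> * ((\<xi> + r *\<^sub>R \<zeta>) \<bullet> (\<xi> + r *\<^sub>R \<zeta>))"
      using \<xi> \<zeta>S subsp by (intro max') (auto intro: subspace_add subspace_scale)
    then have "\<mu> + 2 * r * (\<zeta> \<bullet> (A *v \<xi>)) + r\<^sup>2 * (\<zeta> \<bullet> (A *v \<zeta>))
        \<le> \<mu> + 2 * r * (\<zeta> \<bullet> (\<mu> *\<^sub>R \<xi>)) + r\<^sup>2 * (\<mu> * (\<zeta> \<bullet> \<zeta>))"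
      by (simp add: lin linsc inner_add_left inner_add_right herm[of \<xi> \<zeta>] n1 inner_commute[of \<xi> \<zeta>]
          power2_eq_square \<mu>_def[symmetric] algebra_simps)
    moreover have zz: "\<zeta> \<bullet> (A *v \<xi>) = \<zeta> \<bullet> \<zeta> + \<zeta> \<bullet> (\<mu> *\<^sub>R \<xi>)"
      unfolding inner_add_right[symmetric] by (simp add: \<zeta>_def)
    ultimately show ?thesis unfolding zz c_def by (simp add: algebra_simps)
  qed
  have "\<zeta> \<bullet> \<zeta> \<le> 0"
  proof (rule ccontr)
    assume "\<not> ?thesis"
    then have z: "\<zeta> \<bullet> \<zeta> > 0" by (simp only: not_le)
    \<comment> \<open>A step so small that the quadratic term cannot dominate; the summand 1 keeps
      the denominator positive when \<open>c\<close> is 0.\<close>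
    define r where "r = (\<zeta> \<bullet> \<zeta>) / (c + 1)"
    have r: "r > 0" using z c0 by (simp add: r_def)
    have "2 * (\<zeta> \<bullet> \<zeta>) \<le> r * c" using q[of r] r by (simp add: power2_eq_square)
    also have "\<dots> \<le> r * (c + 1)" using r by simp
    also have "\<dots> = \<zeta> \<bullet> \<zeta>" using c0 by (simp add: r_def)
    finally show False using z by simp
  qed
  then have "\<zeta> = 0" by (metis inner_ge_zero inner_eq_zero_iff order_antisym)
  then have "A *v \<xi> = of_real \<mu> *s \<xi>" by (simp add: \<zeta>_def scR)
  with \<xi> show ?thesis by (rule that)
qed

text \<open>Induction on the number of eigenvectors: a self-adjoint \<open>A\<close> preserves the
  orthogonal complement of those already found, and the next one is taken there.\<close>

lemma hermitian_orthonormal_eigenvectors: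
  fixes A :: "complex^'k^'k"
  assumes A: "adj A = A" and "m \<le> CARD('k)"
  shows "\<exists>E. finite E \<and> card E = m \<and> (\<forall>e\<in>E. \<forall>f\<in>E. cinner e f = (if e = f then 1 else 0)) \<and>
    (\<forall>e\<in>E. \<exists>\<mu>::real. A *v e = of_real \<mu> *s e)"
  using assms(2)
proof (induction m)
  case 0
  then show ?case by (intro exI[of _ "{}"]) simp
next
  case (Suc m)
  then obtain E where E: "finite E" "card E = m"
    and on: "\<forall>e\<in>E. \<forall>f\<in>E. cinner e f = (if e = f then 1 else 0)"
    and eig: "\<forall>e\<in>E. \<exists>\<mu>::real. A *v e = of_real \<mu> *s e" by auto
  define S where "S = {\<xi>. \<forall>e\<in>E. cinner e \<xi> = 0}"
  have S: "vec.subspace S"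
    by (auto simp: vec.subspace_def S_def cinner_add_right cinner_scale_right)
  \<comment> \<open>If the complement were trivial, the orthonormal expansion would put every vector
    into the span of \<open>E\<close>, although \<open>E\<close> has fewer elements than the
    dimension.\<close>
  have "S \<noteq> {0}"
  proof
    assume S0: "S = {0}"
    have "\<xi> \<in> vec.span E" for \<xi>
    proof -
      have "\<xi> - (\<Sum>e\<in>E. cinner e \<xi> *s e) \<in> S"
        using E on by (auto simp: S_def cinner_diff_right cinner_sum_right cinner_scale_right
            if_distrib[of "\<lambda>z. _ * z"] cong: if_cong)
      with S0 have "\<xi> = (\<Sum>e\<in>E. cinner e \<xi> *s e)" by simp
      also have "\<dots> \<in> vec.span E" by (intro vec.span_sum vec.span_scale vec.span_base)
      finally show ?thesis .
    qed
    then have "vec.dim (UNIV :: (complex^'k) set) \<le> card E"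
      using E by (intro vec.dim_le_card) auto
    with Suc.prems E show False by (simp add: card_cart_basis vec.dim_UNIV)
  qed
  moreover have "A *v \<xi> \<in> S" if "\<xi> \<in> S" for \<xi>
  proof -
    have "cinner e (A *v \<xi>) = 0" if e: "e \<in> E" for e
    proof -
      obtain \<mu> :: real where "A *v e = of_real \<mu> *s e" using eig e by blast
      then show ?thesis using e \<open>\<xi> \<in> S\<close> by (simp add: cinner_adj A cinner_scale_left S_def)
    qed
    then show ?thesis by (simp add: S_def)
  qed
  ultimately obtain \<xi> and \<mu> :: real where \<xi>: "\<xi> \<in> S" "norm \<xi> = 1" "A *v \<xi> = of_real \<mu> *s \<xi>"
    using hermitian_eigenvector_in_subspace[OF A S] by metis
  have orth: "cinner e \<xi> = 0" "cinner \<xi> e = 0" if "e \<in> E" for e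
    using \<xi> that cinner_commute[of \<xi> e] by (auto simp: S_def)
  have one: "cinner \<xi> \<xi> = 1" using \<xi> by (simp add: cinner_self)
  then have "\<xi> \<notin> E" using orth by force
  then show ?case
    using E on eig \<xi> orth one by (intro exI[of _ "insert \<xi> E"]) auto
qed

text \<open>The columns of \<open>u\<close> are an orthonormal eigenbasis. The third conclusion
  keeps this visible, so that the signs of the eigenvalues can be read off from the quadratic
  form.\<close>

lemma hermitian_unitary_diag:
  fixes A :: "complex^'k^'k"
  assumes A: "adj A = A"
  obtains u and d :: "'k \<Rightarrow> real"
  where "unitary_mat u" "A = u ** diag_mat (\<lambda>i. of_real (d i)) ** adj u"
    "\<And>i. A *v column i u = of_real (d i) *s column i u"
proof -
  obtain E where E: "finite E" "card E = CARD('k)"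
    and on: "\<forall>e\<in>E. \<forall>f\<in>E. cinner e f = (if e = f then 1 else 0)"
    and eig: "\<forall>e\<in>E. \<exists>\<mu>::real. A *v e = of_real \<mu> *s e"
    using hermitian_orthonormal_eigenvectors[OF A order_refl] by blast
  obtain f where f: "bij_betw f (UNIV :: 'k set) E"
    using E finite_same_card_bij[of "UNIV :: 'k set" E] by auto
  have fE: "f i \<in> E" for i using f by (auto simp: bij_betw_def)
  have finj: "f i = f j \<longleftrightarrow> i = j" for i j using f by (auto simp: bij_betw_def inj_eq)
  have "\<forall>i. \<exists>\<mu>::real. A *v f i = of_real \<mu> *s f i"
    using eig fE by blast
  from choice[OF this]
  obtain d :: "'k \<Rightarrow> real" where d: "\<And>i. A *v f i = of_real (d i) *s f i"
    by blast
  define u :: "complex^'k^'k" where "u = (\<chi> i j. f j $ i)"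
  have col: "column i u = f i" for i by (simp add: column_def u_def vec_eq_iff)
  have "(adj u ** u) $ i $ j = cinner (f i) (f j)" for i j
    by (simp add: adj_def u_def matrix_matrix_mult_def cinner_def)
  then have "(adj u ** u) $ i $ j = (mat 1 :: complex^'k^'k) $ i $ j" for i j
    by (simp add: mat_def on fE finj)
  then have u1: "adj u ** u = mat 1"
    by (simp only: vec_eq_iff) simp
  then have u2: "u ** adj u = mat 1" by (simp add: matrix_left_right_inverse)
  have "(A ** u) $ i $ j = (A *v f j) $ i" for i j
    by (simp add: u_def matrix_matrix_mult_def matrix_vector_mult_def)
  then have "A ** u = u ** diag_mat (\<lambda>i. of_real (d i))"
    by (simp add: vec_eq_iff d u_def matrix_matrix_mult_def diag_mat_def
        if_distrib[of "\<lambda>z. _ * z"] cong: if_cong)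
  then have "A ** (u ** adj u) = u ** diag_mat (\<lambda>i. of_real (d i)) ** adj u"
    by (simp add: matrix_mul_assoc)
  then have "A = u ** diag_mat (\<lambda>i. of_real (d i)) ** adj u" by (simp add: u2)
  then show ?thesis using that[of u d] u1 u2 d by (simp add: unitary_mat_def col)
qed

text \<open>An eigenvalue is the value of the quadratic form at a unit column, hence nonnegative,
  and 0 would give a kernel vector. This is the form in which \<open>cpow_unitary_diag\<close>
  evaluates powers.\<close>

lemma positive_mat_unitary_diag:
  fixes Q :: "complex^'k^'k"
  assumes "positive_mat Q" "invertible Q"
  obtains u and d :: "'k \<Rightarrow> real"
  where "unitary_mat u" "\<forall>i. 0 < d i" "Q = u ** diag_mat (\<lambda>i. of_real (d i)) ** adj u"
proof -
  obtain u and d :: "'k \<Rightarrow> real" where u: "unitary_mat u"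
    and Q: "Q = u ** diag_mat (\<lambda>i. of_real (d i)) ** adj u"
    and eig: "\<And>i. Q *v column i u = of_real (d i) *s column i u"
    using hermitian_unitary_diag[OF positive_mat_adj[OF assms(1)]] by blast
  have "0 < d i" for i
  proof -
    have "(adj u ** u) $ i $ i = 1" using u by (simp add: unitary_mat_def mat_def)
    then have one: "cinner (column i u) (column i u) = 1"
      by (simp add: cinner_def column_def adj_def matrix_matrix_mult_def)
    have "cinner (column i u) (Q *v column i u) \<in> \<real>\<^sub>\<ge>\<^sub>0"
      using assms(1) by (simp add: positive_mat_def)
    then have "0 \<le> d i" by (simp add: eig cinner_scale_right one)
    moreover have "d i \<noteq> 0"
    proof
      assume "d i = 0"
      then have "Q *v column i u = 0" by (simp add: eig)
      then have "column i u = 0"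
        using assms(2) by (metis invertible_def matrix_vector_mul_assoc matrix_vector_mul_lid matrix_vector_mult_0_right)
      with one show False by simp
    qed
    ultimately show ?thesis by simp
  qed
  with u Q that show ?thesis by blast
qed

section \<open>The double commutant theorem\<close>

lemma mat_mult_cscale_left: "cscale c x ** y = cscale c (x ** y)"
  by (simp add: vec_eq_iff cscale_def matrix_matrix_mult_def sum_distrib_left mult.assoc)

lemma mat_mult_cscale_right: "x ** cscale c y = cscale c (x ** y)"
  by (simp add: vec_eq_iff cscale_def matrix_matrix_mult_def sum_distrib_left mult.left_commute)

lemma adj_mat_mult: "adj (x ** y) = adj y ** adj x"
  by (simp add: vec_eq_iff adj_def matrix_matrix_mult_def mult.commute)

lemma adj_add: "adj (x + y) = adj x + adj y"
  by (simp add: vec_eq_iff adj_def)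

lemma star_subalgebraD:
  assumes "star_subalgebra B"
  shows "mat.subspace B" "mat 1 \<in> B" "a \<in> B \<Longrightarrow> adj a \<in> B" "a \<in> B \<Longrightarrow> b \<in> B \<Longrightarrow> a ** b \<in> B"
    "a \<in> B \<Longrightarrow> b \<in> B \<Longrightarrow> a + b \<in> B" "a \<in> B \<Longrightarrow> cscale c a \<in> B" "0 \<in> B"
  using assms by (auto simp: star_subalgebra_def mat.subspace_def)

text \<open>The real inner product of matrices is the real part of the Hilbert--Schmidt pairing, so
  moving a left factor across costs an adjoint, exactly as for the trace.\<close>

lemma mat_inner_mult_left:
  fixes a :: "complex^'m^'k" and x :: "complex^'l^'m"
  shows "(a ** x) \<bullet> y = x \<bullet> (adj a ** y)"
proof -
  have Re: "z \<bullet> w = Re (cnj z * w)" for z w :: complex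
    by (simp add: inner_complex_def)
  have "(a ** x) \<bullet> y = (\<Sum>i\<in>UNIV. \<Sum>j\<in>UNIV. \<Sum>k\<in>UNIV. Re (cnj (a $ i $ k) * cnj (x $ k $ j) * y $ i $ j))"
    by (simp only: inner_vec_def Re matrix_matrix_mult_def vec_lambda_beta cnj_sum complex_cnj_mult
        sum_distrib_right Re_sum)
  also have "\<dots> = (\<Sum>i\<in>UNIV. \<Sum>k\<in>UNIV. \<Sum>j\<in>UNIV. Re (cnj (a $ i $ k) * cnj (x $ k $ j) * y $ i $ j))"
    by (intro sum.cong refl sum.swap)
  also have "\<dots> = (\<Sum>k\<in>UNIV. \<Sum>i\<in>UNIV. \<Sum>j\<in>UNIV. Re (cnj (a $ i $ k) * cnj (x $ k $ j) * y $ i $ j))"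
    by (rule sum.swap)
  also have "\<dots> = (\<Sum>k\<in>UNIV. \<Sum>j\<in>UNIV. \<Sum>i\<in>UNIV. Re (cnj (a $ i $ k) * cnj (x $ k $ j) * y $ i $ j))"
    by (intro sum.cong refl sum.swap)
  also have "\<dots> = x \<bullet> (adj a ** y)"
    by (simp only: inner_vec_def Re matrix_matrix_mult_def vec_lambda_beta adj_def
        sum_distrib_left Re_sum mult.assoc mult.left_commute)
  finally show ?thesis .
qed

section \<open>Matrix units and linear extension\<close>

definition unit_mat :: "'l \<Rightarrow> 'k \<Rightarrow> complex^'k^'l" where
  "unit_mat l k = (\<chi> i j. if i = l \<and> j = k then 1 else 0)"

lemma additive_cscale_sum:
  fixes f :: "complex^'k^'l \<Rightarrow> complex^'k2^'l2"
  assumes "\<And>x y. f (x + y) = f x + f y" "\<And>c x. f (cscale c x) = cscale c (f x)"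
  shows "f (\<Sum>i\<in>I. cscale (c i) (x i)) = (\<Sum>i\<in>I. cscale (c i) (f (x i)))"
proof -
  have "f 0 = 0" using assms(1)[of 0 0] by simp
  then show ?thesis
    by (induction I rule: infinite_finite_induct) (simp_all add: assms)
qed

lemma matrix_eq_sum_unit_mat:
  fixes x :: "complex^'k^'l"
  shows "x = (\<Sum>p\<in>UNIV. cscale (x $ fst p $ snd p) (unit_mat (fst p) (snd p)))"
proof -
  have "(\<Sum>p\<in>UNIV. x $ fst p $ snd p * (if i = fst p \<and> j = snd p then 1 else 0)) = x $ i $ j" for i j
  proof -
    have "(\<Sum>p\<in>UNIV. x $ fst p $ snd p * (if i = fst p \<and> j = snd p then 1 else 0))
        = (\<Sum>p\<in>UNIV. if p = (i, j) then x $ i $ j else 0)"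
      by (intro sum.cong) auto
    then show ?thesis by simp
  qed
  then show ?thesis by (simp add: vec_eq_iff cscale_def unit_mat_def)
qed

lemma additive_cscale_expand:
  fixes f :: "complex^'k^'l \<Rightarrow> complex^'k2^'l2"
  assumes "\<And>x y. f (x + y) = f x + f y" "\<And>c x. f (cscale c x) = cscale c (f x)"
  shows "f x = (\<Sum>p\<in>UNIV. cscale (x $ fst p $ snd p) (f (unit_mat (fst p) (snd p))))"
  using additive_cscale_sum[OF assms, of "\<lambda>p. x $ fst p $ snd p"
      "\<lambda>p. unit_mat (fst p) (snd p)" UNIV]
  by (simp only: matrix_eq_sum_unit_mat[of x, symmetric])

text \<open>The projection is orthogonal for the Hilbert--Schmidt inner product; that \<open>B\<close> is closed under
  adjoints makes its orthogonal complement a left \<open>B\<close>-module.\<close>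

lemma star_subalgebra_projection:
  fixes B :: "(complex^'k^'k) set"
  assumes B: "star_subalgebra B"
  obtains f :: "complex^'k^'k \<Rightarrow> complex^'k^'k"
  where "\<And>x y. f (x + y) = f x + f y" "\<And>c x. f (cscale c x) = cscale c (f x)"
    "\<And>x. f x \<in> B" "\<And>x. x \<in> B \<Longrightarrow> f x = x" "\<And>b x. b \<in> B \<Longrightarrow> f (b ** x) = b ** f x"
proof -
  note B' = star_subalgebraD[OF B]
  define N where "N = {z. \<forall>b\<in>B. b \<bullet> z = 0}"
  have scR: "r *\<^sub>R x = cscale (of_real r) x" for r and x :: "complex^'k^'k"
    by (simp add: vec_eq_iff cscale_def complex_eq_iff)
  have "subspace B" by (simp add: subspace_def B' scR)
  then have span: "span B = B" by (simp add: span_eq_iff)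
  have ex: "\<exists>y. y \<in> B \<and> x - y \<in> N" for x
  proof -
    obtain y z where "y \<in> span B" "\<And>w. w \<in> span B \<Longrightarrow> orthogonal z w" "x = y + z"
      using orthogonal_subspace_decomp_exists[of B x] by metis
    then show ?thesis
      by (intro exI[of _ y]) (auto simp: span N_def orthogonal_def inner_commute)
  qed
  have Nadd: "x + y \<in> N" and Ndiff: "x - y \<in> N" if "x \<in> N" "y \<in> N" for x y
    using that by (simp_all add: N_def inner_add_right inner_diff_right)
  have Nmult: "b ** x \<in> N" if "b \<in> B" "x \<in> N" for b x
  proof -
    have "a \<bullet> (b ** x) = (adj b ** a) \<bullet> x" if "a \<in> B" for a
      using mat_inner_mult_left[of b x a] by (simp only: inner_commute)
    moreover have "adj b ** a \<in> B" if "a \<in> B" for a by (intro B'(3,4) that \<open>b \<in> B\<close>)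
    ultimately show ?thesis using \<open>x \<in> N\<close> by (simp add: N_def)
  qed
  have Nsc: "cscale c x \<in> N" if "x \<in> N" for c x
    using Nmult[of "cscale c (mat 1)" x] that B' by (simp add: mat_mult_cscale_left)
  have BN: "x = 0" if "x \<in> B" "x \<in> N" for x
  proof -
    have "x \<bullet> x = 0" using that by (simp add: N_def)
    then show ?thesis by simp
  qed
  obtain f where f: "\<And>x. f x \<in> B" "\<And>x. x - f x \<in> N"
    using choice[of "\<lambda>x y. y \<in> B \<and> x - y \<in> N"] ex by blast
  \<comment> \<open>As \<open>B\<close> and \<open>N\<close> meet only in 0, \<open>f x\<close> is
    characterised by membership of \<open>B\<close> and of the difference in \<open>N\<close>; each
    property of \<open>f\<close> below is an instance of this.\<close>
  have fI: "f x = y" if "y \<in> B" "x - y \<in> N" for x y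
  proof -
    have "y - f x \<in> B" using mat.subspace_diff[OF B'(1)] f that by blast
    moreover have "y - f x = (x - f x) - (x - y)" by simp
    ultimately have "y - f x = 0" using BN Ndiff f that by metis
    then show ?thesis by simp
  qed
  show ?thesis
  proof (rule that)
    fix x y c
    show "f (x + y) = f x + f y"
    proof (rule fI)
      show "f x + f y \<in> B" by (intro B'(5) f(1))
      have "(x + y) - (f x + f y) = (x - f x) + (y - f y)" by simp
      then show "(x + y) - (f x + f y) \<in> N" using Nadd[OF f(2) f(2)] by metis
    qed
    show "f (cscale c x) = cscale c (f x)"
    proof (rule fI)
      show "cscale c (f x) \<in> B" by (intro B'(6) f(1))
      have "cscale c x - cscale c (f x) = cscale c (x - f x)"
        by (simp add: vec_eq_iff cscale_def right_diff_distrib)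
      then show "cscale c x - cscale c (f x) \<in> N" using Nsc[OF f(2)] by metis
    qed
    show "f x \<in> B" by (rule f)
    show "f x = x" if "x \<in> B" using that by (intro fI) (auto simp: N_def)
    show "f (b ** x) = b ** f x" if b: "b \<in> B" for b
    proof (rule fI)
      show "b ** f x \<in> B" by (intro B'(4) f(1) b)
      have "b ** x - b ** f x = b ** (x - f x)"
        by (simp add: vec_eq_iff matrix_matrix_mult_def right_diff_distrib sum_subtractf)
      then show "b ** x - b ** f x \<in> N" using Nmult[OF b f(2)] by simp
    qed
  qed
qed

text \<open>As a left module the matrix algebra is a sum of copies of the column space. The left
  \<open>B\<close>-linear projection \<open>f\<close> onto \<open>B\<close> is thus a block operator
  whose blocks lie in the commutant. An \<open>x\<close> in the double commutant commutes with these
  blocks, hence left multiplication by \<open>x\<close> commutes with \<open>f\<close>, and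
  evaluation at 1 gives \<open>f x = x\<close>.\<close>

theorem double_commutant:
  fixes B :: "(complex^'k^'k) set"
  assumes B: "star_subalgebra B"
  shows "commutant (commutant B) = B"
proof
  show "B \<subseteq> commutant (commutant B)"
    by (auto simp: commutant_def)
  show "commutant (commutant B) \<subseteq> B"
  proof
    fix x assume x: "x \<in> commutant (commutant B)"
    obtain f where f: "\<And>x y. f (x + y) = f x + f y" "\<And>c x. f (cscale c x) = cscale c (f x)"
      "\<And>x. f x \<in> B" "\<And>x. x \<in> B \<Longrightarrow> f x = x" "\<And>b x. b \<in> B \<Longrightarrow> f (b ** x) = b ** f x"
      using star_subalgebra_projection[OF B] by blast
    \<comment> \<open>\<open>T j k\<close> is the block of \<open>f\<close> from column
      \<open>k\<close> of its argument to column \<open>j\<close> of its value.\<close>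
    define T :: "'k \<Rightarrow> 'k \<Rightarrow> complex^'k^'k" where "T j k = (\<chi> i l. f (unit_mat l k) $ i $ j)" for j k
    have T: "(T j k ** a) $ i $ m = f (a ** unit_mat m k) $ i $ j" for j k i m a
    proof -
      have "a ** unit_mat m k = (\<Sum>l\<in>UNIV. cscale (a $ l $ m) (unit_mat l k))"
        by (simp add: vec_eq_iff cscale_def unit_mat_def matrix_matrix_mult_def
            if_distrib[of "\<lambda>z. _ * z"] if_bool_eq_conj cong: if_cong)
          (simp add: if_distrib[of "\<lambda>z. _ * z"] if_conn cong: if_cong)
      then have "f (a ** unit_mat m k) = (\<Sum>l\<in>UNIV. cscale (a $ l $ m) (f (unit_mat l k)))"
        by (simp add: additive_cscale_sum[OF f(1,2)])
      then show ?thesis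
        by (simp add: T_def matrix_matrix_mult_def cscale_def mult.commute)
    qed
    have T': "(a ** T j k) $ i $ m = (a ** f (unit_mat m k)) $ i $ j" for j k i m a
      by (simp add: T_def matrix_matrix_mult_def)
    have "T j k \<in> commutant B" for j k
      by (auto simp: commutant_def vec_eq_iff T T' f(5))
    then have "T j k ** x = x ** T j k" for j k
      using x by (auto simp: commutant_def)
    then have "f (x ** unit_mat m k) = x ** f (unit_mat m k)" for m k
      using T[of _ k x] T'[of x _ k] by (simp add: vec_eq_iff)
    then have unit: "f (x ** cscale c (unit_mat m k)) = x ** f (cscale c (unit_mat m k))" for c m k
      by (simp add: f mat_mult_cscale_right)
    have f0: "f 0 = 0" using f(1)[of 0 0] by simp
    have "f (x ** (\<Sum>p\<in>I. cscale (c p) (unit_mat (fst p) (snd p))))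
        = x ** f (\<Sum>p\<in>I. cscale (c p) (unit_mat (fst p) (snd p)))" for c and I :: "('k \<times> 'k) set"
      by (induction I rule: infinite_finite_induct) (simp_all add: f0 f(1) unit matrix_add_ldistrib)
    \<comment> \<open>The coefficients are those of the identity in the matrix units; since 1 is in
      \<open>B\<close>, \<open>f\<close> fixes it.\<close>
    from this[of "\<lambda>p. mat 1 $ fst p $ snd p" UNIV] have "f (x ** mat 1) = x ** f (mat 1)"
      unfolding matrix_eq_sum_unit_mat[of "mat 1", symmetric] .
    then have "f x = x" using f(4) star_subalgebraD(2)[OF B] by simp
    then show "x \<in> B" using f(3) by metis
  qed
qed

section \<open>Complex powers\<close>

lemma diag_mat_mult_left: "(diag_mat f ** y) $ i $ j = f i * y $ i $ j"
  by (simp add: diag_mat_def matrix_matrix_mult_def if_distrib[of "\<lambda>z. z * _"] cong: if_cong)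

lemma diag_mat_mult_right: "(y ** diag_mat f) $ i $ j = y $ i $ j * f j"
  by (simp add: diag_mat_def matrix_matrix_mult_def if_distrib[of "\<lambda>z. _ * z"] cong: if_cong)

text \<open>In an eigenbasis, commuting with a diagonal matrix means having zero entries between
  different eigenvalues. The power has equal entries wherever \<open>Q\<close> has, so the same
  zeros suffice for it.\<close>

lemma cpow_in_double_commutant:
  fixes Q :: "complex^'k^'k"
  assumes "positive_mat Q" "invertible Q"
  shows "cpow Q w \<in> commutant (commutant {Q})"
proof -
  obtain u and d :: "'k \<Rightarrow> real" where u: "unitary_mat u" and d: "\<forall>i. 0 < d i"
    and Q: "Q = u ** diag_mat (\<lambda>i. of_real (d i)) ** adj u"
    using positive_mat_unitary_diag[OF assms] by blast
  let ?D = "\<lambda>f. diag_mat (\<lambda>i. f (d i)) :: complex^'k^'k"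
  have uu: "adj u ** u = mat 1" "u ** adj u = mat 1" using u by (auto simp: unitary_mat_def)
  \<comment> \<open>Conjugation by \<open>u\<close> reduces commutation with any function of
    \<open>Q\<close> to commutation with a diagonal matrix.\<close>
  have conj: "u ** ?D f ** adj u ** x = x ** (u ** ?D f ** adj u) \<longleftrightarrow>
      ?D f ** (adj u ** x ** u) = (adj u ** x ** u) ** ?D f" for x f
  proof -
    have "adj u ** (u ** ?D f ** adj u ** x) ** u = ?D f ** (adj u ** x ** u)"
      by (simp add: matrix_mul_assoc uu)
    moreover have "adj u ** (x ** (u ** ?D f ** adj u)) ** u = (adj u ** x ** u) ** ?D f ** (adj u ** u)"
      by (simp only: matrix_mul_assoc)
    moreover have "u ** (adj u ** a ** u) ** adj u = a" for a
    proof -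
      have "u ** (adj u ** a ** u) ** adj u = (u ** adj u) ** a ** (u ** adj u)"
        by (simp only: matrix_mul_assoc)
      then show ?thesis by (simp add: uu)
    qed
    ultimately show ?thesis by (metis uu(1) matrix_mul_rid)
  qed
  have "cpow Q w ** x = x ** cpow Q w" if x: "x ** Q = Q ** x" for x
  proof -
    define y where "y = adj u ** x ** u"
    have "?D of_real ** y = y ** ?D of_real"
      using x conj[of of_real x] unfolding Q y_def by simp
    then have "of_real (d i) * y $ i $ j = y $ i $ j * of_real (d j)" for i j
      by (metis diag_mat_mult_left diag_mat_mult_right)
    then have "y $ i $ j = 0 \<or> d i = d j" for i j
      by (metis mult.commute mult_cancel_left of_real_eq_iff)
    then have "of_real (d i) powr w * y $ i $ j = y $ i $ j * of_real (d j) powr w" for i j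
      by (metis mult.commute mult_zero_left)
    then have "?D (\<lambda>r. of_real r powr w) ** y = y ** ?D (\<lambda>r. of_real r powr w)"
      by (simp add: vec_eq_iff diag_mat_mult_left diag_mat_mult_right)
    then show ?thesis
      using conj[of "\<lambda>r. of_real r powr w" x] unfolding Q cpow_unitary_diag[OF u d] y_def by simp
  qed
  then show ?thesis by (auto simp: commutant_def)
qed

text \<open>Passing to double commutants is monotone, so the powers of \<open>Q\<close> land in that
  of \<open>B\<close>, which is \<open>B\<close> itself.\<close>

lemma cpow_in_star_subalgebra:
  assumes "star_subalgebra B" "Q \<in> B" "positive_mat Q" "invertible Q"
  shows "cpow Q w \<in> B"
proof -
  have "commutant (commutant {Q}) \<subseteq> commutant (commutant B)"
    using assms(2) by (auto simp: commutant_def)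
  then show ?thesis
    using cpow_in_double_commutant[OF assms(3,4)] double_commutant[OF assms(1)] by blast
qed

lemma cpow_minus:
  fixes Q :: "complex^'k^'k"
  assumes "positive_mat Q" "invertible Q"
  shows "cpow Q w ** cpow Q (- w) = mat 1"
proof -
  obtain u and d :: "'k \<Rightarrow> real" where u: "unitary_mat u" and d: "\<forall>i. 0 < d i"
    and Q: "Q = u ** diag_mat (\<lambda>i. of_real (d i)) ** adj u"
    using positive_mat_unitary_diag[OF assms] by blast
  have uu: "adj u ** u = mat 1" "u ** adj u = mat 1" using u by (auto simp: unitary_mat_def)
  let ?D = "\<lambda>w. diag_mat (\<lambda>i. of_real (d i) powr w) :: complex^'k^'k"
  have "of_real (d i) powr w * of_real (d i) powr (- w) = (1 :: complex)" for i
    using d[rule_format, of i] by (simp flip: powr_add)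
  then have D: "?D w ** ?D (- w) = mat 1"
    by (simp add: vec_eq_iff diag_mat_mult_left) (simp add: diag_mat_def mat_def)
  have "cpow Q w ** cpow Q (- w) = u ** ?D w ** (adj u ** u) ** ?D (- w) ** adj u"
    unfolding Q cpow_unitary_diag[OF u d] by (simp only: matrix_mul_assoc)
  also have "\<dots> = u ** (?D w ** ?D (- w)) ** adj u" by (simp add: uu matrix_mul_assoc)
  finally show ?thesis by (simp add: D uu)
qed

section \<open>Tensor products of algebras\<close>

lemma kron_in_tensor_alg: "b \<in> B \<Longrightarrow> c \<in> C \<Longrightarrow> kron b c \<in> tensor_alg B C"
  unfolding tensor_alg_def by (rule mat.span_base) blast

text \<open>Expand the first leg in matrix units, so that the second legs are slices lying in
  \<open>C\<close>. Applying the projection onto \<open>B\<close> to the first leg does not change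
  \<open>X\<close>, whose first-leg slices lie in \<open>B\<close>, but replaces each matrix unit by
  an element of \<open>B\<close>.\<close>

lemma tensor_alg_if_slices:
  fixes X :: "complex^('k::finite \<times> 'l::finite)^('k \<times> 'l)"
  assumes B: "star_subalgebra B"
    and slice1: "\<And>r s. (\<chi> i j. X $ (i, r) $ (j, s)) \<in> B"
    and slice2: "\<And>i j. (\<chi> r s. X $ (i, r) $ (j, s)) \<in> C"
  shows "X \<in> tensor_alg B C"
proof -
  obtain f :: "complex^'k^'k \<Rightarrow> complex^'k^'k"
    where f: "\<And>x y. f (x + y) = f x + f y" "\<And>c x. f (cscale c x) = cscale c (f x)"
      "\<And>x. f x \<in> B" "\<And>x. x \<in> B \<Longrightarrow> f x = x"
    using star_subalgebra_projection[OF B] by metis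
  let ?E = "\<lambda>p. unit_mat (fst p) (snd p) :: complex^'k^'k"
  let ?Y = "\<lambda>p. (\<chi> r s. X $ (fst p, r) $ (snd p, s))"
  have key: "X $ (i, r) $ (j, s) = (\<Sum>p\<in>UNIV. X $ (fst p, r) $ (snd p, s) * f (?E p) $ i $ j)" for i j r s
  proof -
    let ?x = "\<chi> i j. X $ (i, r) $ (j, s)"
    have "?x = (\<Sum>p\<in>UNIV. cscale (?x $ fst p $ snd p) (f (?E p)))"
      using additive_cscale_expand[OF f(1,2), of ?x] by (simp only: f(4)[OF slice1])
    then have "?x $ i $ j = (\<Sum>p\<in>UNIV. cscale (?x $ fst p $ snd p) (f (?E p))) $ i $ j"
      by (rule arg_cong)
    then show ?thesis by (simp add: cscale_def)
  qed
  have entry: "X $ u $ v = (\<Sum>p\<in>UNIV. kron (f (?E p)) (?Y p)) $ u $ v" for u v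
    using key[of "fst u" "snd u" "fst v" "snd v"] by (simp add: kron_def mult.commute)
  have "X = (\<Sum>p\<in>UNIV. kron (f (?E p)) (?Y p))"
    by (intro vec_eq_iff[THEN iffD2] allI entry)
  moreover have "(\<Sum>p\<in>UNIV. kron (f (?E p)) (?Y p)) \<in> tensor_alg B C"
    unfolding tensor_alg_def using f(3) slice2 by (intro mat.span_sum mat.span_base) blast
  ultimately show ?thesis by metis
qed

section \<open>The flip and the product reversed in the second leg\<close>

lemma mat_mult_add_left: "(x + y) ** z = x ** z + y ** z" for x y :: "complex^'k^'l"
  by (simp add: vec_eq_iff matrix_matrix_mult_def distrib_right sum.distrib)

lemma op_mult_add_left: "op_mult (x + y) z = op_mult x z + op_mult y z"
  by (simp add: vec_eq_iff op_mult_def distrib_right sum.distrib)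

lemma op_mult_add_right: "op_mult x (y + z) = op_mult x y + op_mult x z"
  by (simp add: vec_eq_iff op_mult_def distrib_left sum.distrib)

lemma swap_swap [simp]: "swap (swap x) = x"
  by (simp add: vec_eq_iff swap_def)

lemma swap_0 [simp]: "swap 0 = 0"
  by (simp add: vec_eq_iff swap_def)

lemma swap_add: "swap (x + y) = swap x + swap y"
  by (simp add: vec_eq_iff swap_def)

lemma swap_cscale: "swap (cscale c x) = cscale c (swap x)"
  by (simp add: vec_eq_iff swap_def cscale_def)

lemma swap_adj: "swap (adj x) = adj (swap x)"
  by (simp add: vec_eq_iff swap_def adj_def)

text \<open>Exchanging the legs moves the reversed multiplication to the other leg, which amounts to
  reversing the order of the factors.\<close>

lemma op_mult_swap: "op_mult (swap x) (swap y) = swap (op_mult y x)"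
proof -
  have "(\<Sum>r\<in>UNIV. \<Sum>s\<in>UNIV. x $ (s, p) $ (q, r) * y $ (p', r) $ (s, q'))
      = (\<Sum>r\<in>UNIV. \<Sum>s\<in>UNIV. y $ (p', s) $ (r, q') * x $ (r, p) $ (q, s))" for p q p' q'
    by (subst sum.swap) (simp only: mult.commute)
  then show ?thesis
    by (simp add: vec_eq_iff op_mult_def swap_def)
qed

lemma swap_tensor_alg:
  assumes "x \<in> tensor_alg B C"
  shows "swap x \<in> tensor_alg C B"
  using assms unfolding tensor_alg_def
proof (induction rule: mat.span_induct_alt)
  case base
  show ?case by (simp add: mat.span_zero)
next
  case (step c x y)
  then obtain b d where "x = kron b d" "b \<in> B" "d \<in> C" by blast
  then have "swap x \<in> mat.span {kron b c |b c. b \<in> C \<and> c \<in> B}"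
    by (auto simp: swap_kron intro!: mat.span_base)
  with step show ?case
    by (simp add: swap_add swap_cscale mat.span_add mat.span_scale)
qed

text \<open>For equal parameters \<open>Psi'\<close> is \<open>swap\<close> after
  \<open>Psi\<close>; this transfers the bijection from one to the other.\<close>

lemma bij_betw_swap: "bij_betw swap (swap_idempotents B) (swap_idempotents B)"
proof (rule bij_betwI[where g = swap])
  show "swap \<in> swap_idempotents B \<rightarrow> swap_idempotents B"
    by (auto simp: swap_idempotents_def op_mult_swap swap_tensor_alg simp flip: swap_adj)
  then show "swap \<in> swap_idempotents B \<rightarrow> swap_idempotents B" .
qed simp_all

section \<open>Operators on the GNS space\<close>

text \<open>Matrix units are rank-one operators and a scalar can be absorbed into the second vector,
  so sums alone generate everything from \<open>theta\<close>.\<close>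

lemma matrix_theta_induct [case_names theta add]:
  fixes x :: "complex^'k^'l"
  assumes theta: "\<And>\<xi> \<eta>. P (theta \<xi> \<eta>)" and add: "\<And>x y. P x \<Longrightarrow> P y \<Longrightarrow> P (x + y)"
  shows "P x"
proof -
  have unit: "P (cscale c (unit_mat l k))" for c l k
  proof -
    have "cscale c (unit_mat l k) = theta (axis k 1) (c *s axis l 1)"
      by (simp add: vec_eq_iff cscale_def unit_mat_def theta_def axis_def)
    then show ?thesis by (simp add: theta)
  qed
  have "theta 0 0 = (0 :: complex^'k^'l)"
    by (simp add: vec_eq_iff theta_def)
  then have 0: "P 0" using theta[of 0 0] by simp
  have "P (\<Sum>p\<in>I. cscale (c p) (unit_mat (fst p) (snd p)))" for I c
    by (induction I rule: infinite_finite_induct) (simp_all add: 0 unit add)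
  then show ?thesis by (subst matrix_eq_sum_unit_mat)
qed

section \<open>Calculus of rank-one operators\<close>

lemma theta_kron: "kron (theta \<xi> \<eta>) (theta \<xi>' \<eta>') = theta (vtensor \<xi> \<xi>') (vtensor \<eta> \<eta>')"
  by (simp add: vec_eq_iff kron_def theta_def vtensor_def)

lemma adj_theta: "adj (theta \<xi> \<eta>) = theta \<eta> \<xi>"
  by (simp add: vec_eq_iff adj_def theta_def)

lemma mult_theta: "x ** theta \<xi> \<eta> = theta \<xi> (x *v \<eta>)"
  by (simp add: vec_eq_iff theta_def matrix_matrix_mult_def matrix_vector_mult_def
      sum_distrib_right mult.assoc)

lemma theta_mult_adj: "theta \<xi> \<eta> ** adj x = theta (x *v \<xi>) \<eta>"
  by (metis adj_adj adj_mat_mult adj_theta mult_theta)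

text \<open>The linear extension of
  \<open>theta \<xi> \<eta> \<mapsto> kron (adj (s \<xi>)) (s \<eta>)\<close>, given by its values
  on matrix units. The column index of \<open>X\<close> feeds the first leg because the unit at row
  \<open>i\<close> and column \<open>j\<close> is
  \<open>theta (axis j 1) (axis i 1)\<close>.\<close>

definition theta_rep :: "(complex^'d \<Rightarrow> complex^'n^'n) \<Rightarrow> complex^'d^'d \<Rightarrow> complex^('n \<times> 'n)^('n \<times> 'n)" where
  "theta_rep s X =
    (\<Sum>p\<in>UNIV. cscale (X $ fst p $ snd p) (kron (adj (s (axis (snd p) 1))) (s (axis (fst p) 1))))"

lemma theta_rep_add: "theta_rep s (X + Y) = theta_rep s X + theta_rep s Y"
  by (simp add: theta_rep_def mat.scale_left_distrib sum.distrib)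

lemma theta_rep_cscale: "theta_rep s (cscale c X) = cscale c (theta_rep s X)"
proof -
  have "cscale c X $ i $ j = c * X $ i $ j" for i j by (simp add: cscale_def)
  then show ?thesis by (simp add: theta_rep_def mat.scale_sum_right)
qed

lemma linear_theta_rep: "Vector_Spaces.linear cscale cscale (theta_rep s)"
  by (simp add: Vector_Spaces.linear_iff theta_rep_add theta_rep_cscale mat.vector_space_axioms)

locale linear_into_matrices =
  fixes s :: "complex^'d \<Rightarrow> complex^'n^'n"
  assumes s_add: "s (x + y) = s x + s y" and s_scale: "s (c *s x) = cscale c (s x)"
begin

lemma s_entry: "s \<xi> $ a $ b = (\<Sum>i\<in>UNIV. \<xi> $ i * s (axis i 1) $ a $ b)"
proof -
  have "s 0 = 0" using s_add[of 0 0] by simp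
  then have "s (\<Sum>i\<in>I. \<xi> $ i *s axis i 1) = (\<Sum>i\<in>I. cscale (\<xi> $ i) (s (axis i 1)))" for I
    by (induction I rule: infinite_finite_induct) (simp_all add: s_add s_scale)
  then have "s \<xi> = (\<Sum>i\<in>UNIV. cscale (\<xi> $ i) (s (axis i 1)))"
    by (metis basis_expansion)
  then have "s \<xi> $ a $ b = (\<Sum>i\<in>UNIV. cscale (\<xi> $ i) (s (axis i 1))) $ a $ b"
    by (rule arg_cong)
  then show ?thesis by (simp add: cscale_def)
qed

lemma theta_rep_entry:
  "theta_rep s X $ (a, c) $ (b, d) =
    (\<Sum>i\<in>UNIV. (\<Sum>j\<in>UNIV. X $ i $ j * cnj (s (axis j 1) $ b $ a)) * s (axis i 1) $ c $ d)"
  by (simp add: theta_rep_def cscale_def kron_def adj_def sum.cartesian_product case_prod_unfold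
      sum_distrib_right mult.assoc)

lemma theta_rep_theta: "theta_rep s (theta \<xi> \<eta>) = kron (adj (s \<xi>)) (s \<eta>)"
proof -
  have "(\<Sum>j\<in>UNIV. theta \<xi> \<eta> $ i $ j * cnj (s (axis j 1) $ b $ a)) = \<eta> $ i * cnj (s \<xi> $ b $ a)"
    for i a b
    by (simp add: theta_def s_entry[of \<xi>] sum_distrib_left mult.assoc)
  then have "theta_rep s (theta \<xi> \<eta>) $ (a, c) $ (b, d) = cnj (s \<xi> $ b $ a) * s \<eta> $ c $ d" for a b c d
    by (simp add: theta_rep_entry s_entry[of \<eta>] sum_distrib_left mult.assoc mult.left_commute)
  then show ?thesis by (simp add: vec_eq_iff kron_def adj_def)
qed

text \<open>Rank-one operators generate all operators under addition. This resolves the definite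
  descriptions of \<open>Psi\<close> and \<open>Psi'\<close>.\<close>

lemma theta_rep_unique:
  assumes "Vector_Spaces.linear cscale cscale F" "\<And>\<xi> \<eta>. F (theta \<xi> \<eta>) = kron (adj (s \<xi>)) (s \<eta>)"
  shows "F = theta_rep s"
proof
  fix X show "F X = theta_rep s X"
    using assms by (induction X rule: matrix_theta_induct)
      (simp_all add: theta_rep_theta theta_rep_add Vector_Spaces.linear_iff)
qed

text \<open>The adjoint of a rank-one operator exchanges its two vectors, that is, the two legs;
  \<open>adj\<close> then puts the star back on the first one.\<close>

lemma theta_rep_adj: "theta_rep s (adj X) = swap (adj (theta_rep s X))"
  by (induction X rule: matrix_theta_induct)
    (simp_all add: adj_theta theta_rep_theta adj_kron swap_kron adj_add theta_rep_add swap_add)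

text \<open>The legs are peeled off one at a time: injectivity of \<open>s\<close> on the second leg
  annihilates the coefficient vectors, and then injectivity on the first leg annihilates the rows of
  \<open>X\<close>.\<close>

lemma inj_theta_rep:
  assumes "inj s"
  shows "inj (theta_rep s)"
proof -
  have s0: "s 0 = 0" using s_add[of 0 0] by simp
  have zero: "v = 0" if "\<And>c d. s v $ c $ d = 0" for v
  proof -
    have "s v = 0" using that by (simp add: vec_eq_iff)
    then show ?thesis using assms s0 by (metis injD)
  qed
  have "X = 0" if "theta_rep s X = 0" for X
  proof -
    have "(\<chi> i. \<Sum>j\<in>UNIV. X $ i $ j * cnj (s (axis j 1) $ b $ a)) = 0" for a b
    proof (rule zero)
      fix c d
      show "s (\<chi> i. \<Sum>j\<in>UNIV. X $ i $ j * cnj (s (axis j 1) $ b $ a)) $ c $ d = 0"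
        using that theta_rep_entry[of X a c b d] by (simp add: s_entry[of "vec_lambda _"])
    qed
    then have sum0: "(\<Sum>j\<in>UNIV. X $ i $ j * cnj (s (axis j 1) $ b $ a)) = 0" for a b i
      by (simp add: vec_eq_iff)
    \<comment> \<open>The first leg carries an adjoint, so the row must be conjugated before
      \<open>s\<close> can absorb it.\<close>
    have "(\<chi> j. cnj (X $ i $ j)) = 0" for i
    proof (rule zero)
      fix b a
      have "cnj (s (\<chi> j. cnj (X $ i $ j)) $ b $ a) = 0"
        using sum0[of i b a] by (simp add: s_entry[of "vec_lambda _"])
      then show "s (\<chi> j. cnj (X $ i $ j)) $ b $ a = 0" by simp
    qed
    then show ?thesis by (simp add: vec_eq_iff)
  qed
  moreover have "theta_rep s (X - Y) = theta_rep s X - theta_rep s Y" for X Y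
    using theta_rep_add[of s "X - Y" Y] by simp
  ultimately show ?thesis by (metis injI eq_iff_diff_eq_0)
qed

lemma range_theta_rep:
  assumes B: "star_subalgebra B" and s: "range s = B"
  shows "range (theta_rep s) = tensor_alg B B"
proof
  have "kron (adj (s \<xi>)) (s \<eta>) \<in> tensor_alg B B" for \<xi> \<eta>
    using s star_subalgebraD(3)[OF B] by (blast intro: kron_in_tensor_alg)
  then show "range (theta_rep s) \<subseteq> tensor_alg B B"
    unfolding theta_rep_def tensor_alg_def
    by (intro image_subsetI mat.span_sum mat.span_scale)
  have "mat.subspace (range (theta_rep s))"
    unfolding mat.subspace_def
  proof (intro conjI ballI allI)
    have "theta_rep s 0 = 0" by (simp add: theta_rep_def)
    then show "0 \<in> range (theta_rep s)" by (metis rangeI)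
  qed (auto simp flip: theta_rep_add theta_rep_cscale)
  moreover have "kron b c \<in> range (theta_rep s)" if bc: "b \<in> B" "c \<in> B" for b c
  proof -
    \<comment> \<open>The first leg is of the form \<open>adj (s \<xi>)\<close>, so it is the
      adjoint of \<open>b\<close> that is lifted through \<open>s\<close>.\<close>
    obtain \<xi> \<eta> where "adj b = s \<xi>" "c = s \<eta>"
      using bc s star_subalgebraD(3)[OF B, of b] by (metis imageE)
    then have "theta_rep s (theta \<xi> \<eta>) = kron b c"
      by (metis theta_rep_theta adj_adj)
    then show ?thesis by (metis rangeI)
  qed
  ultimately show "tensor_alg B B \<subseteq> range (theta_rep s)"
    unfolding tensor_alg_def by (intro mat.span_minimal) auto
qed

text \<open>On rank-one operators, \<open>m\<close> multiplies the vectors in both slots. The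
  adjoint in the first leg and the opposite product in the second both reverse the order, which is
  why \<open>Y\<close> precedes \<open>X\<close> on the right.\<close>

lemma theta_rep_schur_product:
  assumes m: "\<And>\<xi> \<eta>. s (m *v vtensor \<xi> \<eta>) = s \<xi> ** s \<eta>"
  shows "theta_rep s (m ** kron X Y ** adj m) = op_mult (theta_rep s Y) (theta_rep s X)"
proof -
  have kron_add: "kron (X + X') Y = kron X Y + kron X' Y" "kron Y (X + X') = kron Y X + kron Y X'"
    for X X' Y :: "complex^'d^'d"
    by (simp_all add: vec_eq_iff kron_def distrib_right distrib_left)
  show ?thesis
  proof (induction X rule: matrix_theta_induct)
    case (theta \<xi> \<eta>)
    show ?case
      by (induction Y rule: matrix_theta_induct)
        (simp_all add: theta_kron mult_theta theta_mult_adj theta_rep_theta m op_mult_kron adj_mat_mult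
          kron_add matrix_add_ldistrib mat_mult_add_left theta_rep_add op_mult_add_left)
  next
    case (add X X')
    then show ?case
      by (simp add: kron_add matrix_add_ldistrib mat_mult_add_left theta_rep_add op_mult_add_right)
  qed
qed

end

section \<open>Idempotents and decompositions\<close>

lemma act_act [simp]: "act (act x) = x"
  by (simp add: vec_eq_iff act_def)

lemma act_eq_iff [simp]: "act x = act y \<longleftrightarrow> x = y"
  by (metis act_act)

lemma act_0 [simp]: "act 0 = 0"
  by (simp add: vec_eq_iff act_def)

lemma act_add: "act (x + y) = act x + act y"
  by (simp add: vec_eq_iff act_def)

lemma act_cscale: "act (cscale c x) = cscale c (act x)"
  by (simp add: vec_eq_iff act_def cscale_def)

lemma tensor_alg_induct [consumes 1, case_names zero step]:
  assumes "x \<in> tensor_alg B C" and "P 0"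
    and "\<And>c a b y. a \<in> B \<Longrightarrow> b \<in> C \<Longrightarrow> P y \<Longrightarrow> P (cscale c (kron a b) + y)"
  shows "P x"
  using assms(1) unfolding tensor_alg_def
  by (induction rule: mat.span_induct_alt) (use assms(2,3) in auto)

lemma op_mult_0 [simp]: "op_mult 0 x = 0" "op_mult x 0 = 0"
  by (simp_all add: vec_eq_iff op_mult_def)

lemma op_mult_cscale_left: "op_mult (cscale c x) y = cscale c (op_mult x y)"
  by (simp add: vec_eq_iff op_mult_def cscale_def sum_distrib_left mult.assoc)

lemma op_mult_cscale_right: "op_mult x (cscale c y) = cscale c (op_mult x y)"
  by (simp add: vec_eq_iff op_mult_def cscale_def sum_distrib_left mult.left_commute)

lemma tensor_alg_commutant_commute:
  assumes "e \<in> tensor_alg B C" "x \<in> tensor_alg (commutant B) (commutant C)"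
  shows "op_mult e x = op_mult x e"
  using assms(1)
proof (induction rule: tensor_alg_induct)
  case (step c a b y)
  have "op_mult (kron a b) x = op_mult x (kron a b)"
    using assms(2)
  proof (induction rule: tensor_alg_induct)
    case (step c' a' b' y')
    have "a ** a' = a' ** a" "b ** b' = b' ** b"
      using step(1,2) \<open>a \<in> B\<close> \<open>b \<in> C\<close> by (auto simp: commutant_def)
    then show ?case
      using step(3) by (simp add: op_mult_add_left op_mult_add_right op_mult_cscale_left
          op_mult_cscale_right op_mult_kron)
  qed simp
  with step(3) show ?case
    by (simp add: op_mult_add_left op_mult_add_right op_mult_cscale_left op_mult_cscale_right)
qed simp

section \<open>The antilinear involution\<close>

lemma J0_J0 [simp]: "J0 (J0 v) = v"
  by (simp add: vec_eq_iff J0_def)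

lemma J0_0 [simp]: "J0 0 = 0"
  by (simp add: vec_eq_iff J0_def)

lemma J0_diff: "J0 (v - w) = J0 v - J0 w"
  by (simp add: vec_eq_iff J0_def)

lemma J0_image_eqI:
  assumes "\<And>v. v \<in> S \<Longrightarrow> J0 v \<in> S"
  shows "J0 ` S = S"
  using assms by (metis J0_J0 image_eqI image_subsetI subsetI subset_antisym)

text \<open>Conjugating an action by \<open>J0\<close> amounts to applying
  \<open>swap \<circ> adj\<close>; hence the condition \<open>e = swap (adj e)\<close> says that the
  action of \<open>e\<close> commutes with \<open>J0\<close>.\<close>

lemma J0_act: "J0 (act e *v v) = act (swap (adj e)) *v J0 v"
proof -
  have "(\<Sum>r\<in>UNIV. cnj (e $ (p, snd r) $ (fst r, q)) * cnj (v $ r))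
      = (\<Sum>r\<in>UNIV. cnj (e $ (p, fst r) $ (snd r, q)) * cnj (v $ (snd r, fst r)))" for p q
    by (rule sum.reindex_bij_witness[of _ prod.swap prod.swap]) auto
  then show ?thesis
    by (simp add: vec_eq_iff J0_def act_def swap_def adj_def matrix_vector_mult_def)
qed

lemma swap_idempotentsD:
  assumes "e \<in> swap_idempotents B"
  shows "act e *v (act e *v v) = act e *v v" "J0 (act e *v v) = act e *v J0 v"
proof -
  have "act e ** act e = act e" "swap (adj e) = e"
    using assms by (auto simp: swap_idempotents_def simp flip: act_op_mult)
  then show "act e *v (act e *v v) = act e *v v" "J0 (act e *v v) = act e *v J0 v"
    by (simp_all add: matrix_vector_mul_assoc J0_act)
qed

text \<open>Image and kernel inherit what commutes with the operator: idempotency gives the direct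
  sum, commutation with the tensor product of the commutants gives invariance, and commutation with
  \<open>J0\<close> gives the remaining clause.\<close>

lemma im_ker_in_invariant_decomps:
  fixes B :: "(complex^'n^'n) set"
  assumes e: "e \<in> swap_idempotents B"
  shows "im_ker e \<in> invariant_decomps B"
proof -
  note idem = swap_idempotentsD(1)[OF e] and J = swap_idempotentsD(2)[OF e]
  let ?V = "range (\<lambda>v. act e *v v)" and ?W = "{v. act e *v v = 0}"
  have comm: "act e *v (act x *v v) = act x *v (act e *v v)"
    if "x \<in> tensor_alg (commutant B) (commutant B)" for x v
    using tensor_alg_commutant_commute[OF _ that, of e] e
    by (simp add: swap_idempotents_def matrix_vector_mul_assoc flip: act_op_mult)
  have "vec.subspace ?V"
    unfolding vec.subspace_def
  proof (intro conjI allI ballI)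
    have "act e *v 0 = 0" by simp
    then show "0 \<in> ?V" by (metis rangeI)
  qed (auto simp flip: matrix_vector_right_distrib vector_scalar_commute)
  moreover have "vec.subspace ?W"
    by (simp add: vec.subspace_def matrix_vector_right_distrib vector_scalar_commute)
  moreover have "?V \<inter> ?W = {0}"
  proof -
    have "0 = act e *v 0" by simp
    then have "0 \<in> ?V" by (rule range_eqI)
    then show ?thesis by (auto simp: idem)
  qed
  moreover have "{v + w | v w. v \<in> ?V \<and> w \<in> ?W} = UNIV"
  proof -
    have "\<exists>v w. x = v + w \<and> v \<in> ?V \<and> w \<in> ?W" for x
      by (rule exI[of _ "act e *v x"], rule exI[of _ "x - act e *v x"])
        (simp add: matrix_vector_mult_diff_distrib idem)
    then show ?thesis by blast
  qed
  moreover have "\<forall>x\<in>tensor_alg (commutant B) (commutant B).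
      (\<forall>v\<in>?V. act x *v v \<in> ?V) \<and> (\<forall>w\<in>?W. act x *v w \<in> ?W)"
  proof (intro ballI conjI)
    fix x v assume x: "x \<in> tensor_alg (commutant B) (commutant B)"
    show "act x *v v \<in> ?V" if "v \<in> ?V" using that by (auto simp flip: comm[OF x])
    show "act x *v v \<in> ?W" if "v \<in> ?W" using that by (simp add: comm[OF x])
  qed
  moreover have "J0 ` ?V = ?V"
    by (rule J0_image_eqI) (auto simp: J)
  moreover have "J0 ` ?W = ?W"
    by (rule J0_image_eqI) (simp flip: J)
  ultimately show ?thesis by (simp add: im_ker_def invariant_decomps_def)
qed

lemma inj_on_im_ker: "inj_on im_ker (swap_idempotents B)"
proof (rule inj_onI)
  fix e f assume e: "e \<in> swap_idempotents B" and f: "f \<in> swap_idempotents B" and "im_ker e = im_ker f"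
  then have im: "range (\<lambda>v. act e *v v) = range (\<lambda>v. act f *v v)"
    and ker: "{v. act e *v v = 0} = {v. act f *v v = 0}" by (simp_all add: im_ker_def)
  have "act f *v v = act e *v v" for v
  proof -
    obtain w where w: "act e *v v = act f *v w" using im by blast
    \<comment> \<open>The part of \<open>v\<close> in the common kernel is killed by
      \<open>f\<close> as well, while the part in the common image is fixed by
      \<open>f\<close>.\<close>
    have "act e *v (v - act e *v v) = 0"
      by (simp add: matrix_vector_mult_diff_distrib swap_idempotentsD[OF e])
    then have "act f *v (v - act e *v v) = 0" using ker by blast
    then show ?thesis
      by (simp add: matrix_vector_mult_diff_distrib w swap_idempotentsD[OF f])
  qed
  then have "act e = act f" unfolding matrix_eq by simp
  then show "e = f" by simp
qed

text \<open>Commuting with the elementary tensors that have a unit in one leg puts every slice in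
  the other leg into the double commutant of \<open>B\<close>, and membership can be tested on
  slices.\<close>

lemma tensor_alg_if_commutes:
  fixes e :: "complex^('n::finite \<times> 'n)^('n \<times> 'n)"
  assumes B: "star_subalgebra B"
    and comm: "\<And>x. x \<in> tensor_alg (commutant B) (commutant B) \<Longrightarrow> op_mult x e = op_mult e x"
  shows "e \<in> tensor_alg B B"
proof (rule tensor_alg_if_slices[OF B])
  have one: "mat 1 \<in> commutant B" by (simp add: commutant_def)
  fix r s
  let ?X = "\<chi> i j. e $ (i, r) $ (j, s)"
  have "?X \<in> commutant (commutant B)"
    unfolding commutant_def[of "commutant B"]
  proof (intro CollectI ballI)
    fix x assume x: "x \<in> commutant B"
    have "(x ** ?X) $ i $ j = (?X ** x) $ i $ j" for i j
    proof -
      have "op_mult (kron x (mat 1)) e $ (i, r) $ (j, s) = op_mult e (kron x (mat 1)) $ (i, r) $ (j, s)"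
        by (simp only: comm[OF kron_in_tensor_alg[OF x one]])
      then show ?thesis
        by (simp add: op_mult_def kron_def mat_def matrix_matrix_mult_def
            if_distrib[of "\<lambda>z. _ * z"] if_distrib[of "\<lambda>z. z * _"] cong: if_cong)
    qed
    then show "?X ** x = x ** ?X" by (intro vec_eq_iff[THEN iffD2] allI) metis
  qed
  then show "?X \<in> B" by (simp only: double_commutant[OF B])
next
  have one: "mat 1 \<in> commutant B" by (simp add: commutant_def)
  fix i j
  let ?X = "\<chi> r s. e $ (i, r) $ (j, s)"
  have "?X \<in> commutant (commutant B)"
    unfolding commutant_def[of "commutant B"]
  proof (intro CollectI ballI)
    fix x assume x: "x \<in> commutant B"
    have "(x ** ?X) $ r $ s = (?X ** x) $ r $ s" for r s
    proof -
      have "op_mult (kron (mat 1) x) e $ (i, r) $ (j, s) = op_mult e (kron (mat 1) x) $ (i, r) $ (j, s)"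
        by (simp only: comm[OF kron_in_tensor_alg[OF one x]])
      \<comment> \<open>The Kronecker delta of \<open>mat 1\<close> now sits on the outer summation
        index; exchanging the sums lets it collapse.\<close>
      then show ?thesis
        by (subst (asm) (1 2) op_mult_def, subst (asm) (1) sum.swap, subst (asm) (2) sum.swap)
          (simp add: kron_def mat_def matrix_matrix_mult_def mult.commute
            if_distrib[of "\<lambda>z. _ * z"] if_distrib[of "\<lambda>z. z * _"] cong: if_cong)
    qed
    then show "?X ** x = x ** ?X" by (intro vec_eq_iff[THEN iffD2] allI) metis
  qed
  then show "?X \<in> B" by (simp only: double_commutant[OF B])
qed

text \<open>The idempotent comes from the projection \<open>p\<close> onto \<open>V\<close> along
  \<open>W\<close>. Uniqueness of the decomposition, in the form \<open>pI\<close>, gives linearity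
  of \<open>p\<close> and its commutation with everything that preserves both summands.\<close>

lemma im_ker_surj:
  assumes B: "star_subalgebra B" and VW: "(V, W) \<in> invariant_decomps B"
  obtains e where "e \<in> swap_idempotents B" "im_ker e = (V, W)"
proof -
  have V: "vec.subspace V" and W: "vec.subspace W" and VW0: "V \<inter> W = {0}"
    and sum: "{v + w | v w. v \<in> V \<and> w \<in> W} = UNIV"
    and invV: "\<And>x v. x \<in> tensor_alg (commutant B) (commutant B) \<Longrightarrow> v \<in> V \<Longrightarrow> act x *v v \<in> V"
    and invW: "\<And>x v. x \<in> tensor_alg (commutant B) (commutant B) \<Longrightarrow> v \<in> W \<Longrightarrow> act x *v v \<in> W"
    and JV: "J0 ` V = V" and JW: "J0 ` W = W"
    using VW by (simp_all add: invariant_decomps_def)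
  have "\<exists>y. y \<in> V \<and> v - y \<in> W" for v
  proof -
    have "v \<in> {v + w | v w. v \<in> V \<and> w \<in> W}" using sum by blast
    then obtain a b where "v = a + b" "a \<in> V" "b \<in> W" by blast
    then show ?thesis by (intro exI[of _ a]) simp
  qed
  then obtain p where p: "\<And>v. p v \<in> V" "\<And>v. v - p v \<in> W"
    using choice[of "\<lambda>v y. y \<in> V \<and> v - y \<in> W"] by blast
  have pI: "p v = y" if "y \<in> V" "v - y \<in> W" for v y
  proof -
    have "p v - y \<in> V" using vec.subspace_diff[OF V p(1) that(1)] .
    moreover have "(v - y) - (v - p v) \<in> W" using vec.subspace_diff[OF W that(2) p(2)] .
    moreover have "(v - y) - (v - p v) = p v - y" by simp
    ultimately have "p v - y \<in> V \<inter> W" by simp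
    then show ?thesis using VW0 by simp
  qed
  have lin: "Vector_Spaces.linear (*s) (*s) p"
  proof (unfold Vector_Spaces.linear_iff, intro conjI allI vec.vector_space_axioms)
    fix v w c
    show "p (v + w) = p v + p w"
    proof (rule pI)
      show "p v + p w \<in> V" by (intro vec.subspace_add[OF V] p)
      have "(v - p v) + (w - p w) \<in> W" by (intro vec.subspace_add[OF W] p)
      then show "v + w - (p v + p w) \<in> W" by (simp add: algebra_simps)
    qed
    show "p (c *s v) = c *s p v"
    proof (rule pI)
      show "c *s p v \<in> V" by (intro vec.subspace_scale[OF V] p)
      have "c *s (v - p v) \<in> W" by (intro vec.subspace_scale[OF W] p)
      then show "c *s v - c *s p v \<in> W" by (simp add: vec.scale_right_diff_distrib)
    qed
  qed
  \<comment> \<open>Since \<open>act\<close> is an involution, this \<open>e\<close> acts as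
    \<open>p\<close>.\<close>
  define e where "e = act (matrix p)"
  have e: "act e *v v = p v" for v
    by (simp add: e_def matrix_works[OF lin])
  have pV: "p v = v" if "v \<in> V" for v
    using that W by (intro pI) (simp_all add: vec.subspace_0)
  have ker: "p v = 0 \<longleftrightarrow> v \<in> W" for v
    using p(2)[of v] pI[of 0 v] vec.subspace_0[OF V] by auto
  have "range p = V" using p pV by (metis image_subset_iff rangeI subsetI subset_antisym)
  then have "im_ker e = (V, W)"
    by (simp add: im_ker_def e ker)
  moreover have "e \<in> swap_idempotents B"
  proof -
    have "op_mult x e = op_mult e x" if x: "x \<in> tensor_alg (commutant B) (commutant B)" for x
    proof -
      have "p (act x *v v) = act x *v p v" for v
        using invV[OF x p(1)] invW[OF x p(2)] by (intro pI) (simp_all flip: matrix_vector_mult_diff_distrib)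
      then have "act (op_mult x e) = act (op_mult e x)"
        by (simp add: matrix_eq act_op_mult e flip: matrix_vector_mul_assoc)
      then show ?thesis by simp
    qed
    then have "e \<in> tensor_alg B B" by (rule tensor_alg_if_commutes[OF B])
    moreover have "act (op_mult e e) = act e"
      by (simp add: matrix_eq act_op_mult e pV p flip: matrix_vector_mul_assoc)
    moreover have "act (swap (adj e)) = act e"
    proof -
      have "p (J0 v) = J0 (p v)" for v
      proof (rule pI)
        show "J0 (p v) \<in> V" using p(1) JV by blast
        show "J0 v - J0 (p v) \<in> W" using p(2) JW by (simp flip: J0_diff) blast
      qed
      then have "act (swap (adj e)) *v J0 v = act e *v J0 v" for v
        by (simp add: e flip: J0_act)
      then have "act (swap (adj e)) *v v = act e *v v" for v
        by (metis J0_J0)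
      then show ?thesis by (simp add: matrix_eq)
    qed
    ultimately show ?thesis by (simp add: swap_idempotents_def)
  qed
  ultimately show ?thesis by (rule that[rotated])
qed

lemma bij_betw_im_ker:
  assumes "star_subalgebra B"
  shows "bij_betw im_ker (swap_idempotents B) (invariant_decomps B)"
  unfolding bij_betw_def
proof (intro conjI inj_on_im_ker subset_antisym subsetI)
  fix VW assume "VW \<in> im_ker ` swap_idempotents B"
  then show "VW \<in> invariant_decomps B" by (auto intro: im_ker_in_invariant_decomps)
next
  fix VW assume "VW \<in> invariant_decomps B"
  then show "VW \<in> im_ker ` swap_idempotents B"
    using im_ker_surj[OF assms] by (metis image_eqI surj_pair)
qed

section \<open>Bimodules\<close>

lemma hs_add: "hs (x + y) = hs x + hs y"
  by (simp add: vec_eq_iff hs_def)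

lemma hs_cscale: "hs (cscale c x) = c *s hs x"
  by (simp add: vec_eq_iff hs_def cscale_def)

lemma hs_0 [simp]: "hs 0 = 0"
  by (simp add: vec_eq_iff hs_def)

lemma hs_adj: "hs (adj x) = J0 (hs x)"
  by (simp add: vec_eq_iff hs_def adj_def J0_def)

lemma bij_hs: "bij hs"
proof (rule bijI)
  show "inj hs" by (rule injI) (simp add: vec_eq_iff hs_def)
  have "v = hs (\<chi> i j. v $ (i, j))" for v by (simp add: vec_eq_iff hs_def)
  then show "surj hs" by (rule surjI[OF sym])
qed

text \<open>The row-major vectorisation identity: \<open>act\<close> transposes \<open>y\<close>,
  and a transposed second leg acts as right multiplication.\<close>

lemma hs_mult: "hs (x ** v ** y) = act (kron x y) *v hs v"
proof -
  have "(\<Sum>l\<in>UNIV. (\<Sum>k\<in>UNIV. x $ i $ k * v $ k $ l) * y $ l $ j)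
      = (\<Sum>q\<in>UNIV. x $ i $ fst q * y $ snd q $ j * v $ fst q $ snd q)" for i j
  proof -
    have "(\<Sum>l\<in>UNIV. (\<Sum>k\<in>UNIV. x $ i $ k * v $ k $ l) * y $ l $ j)
        = (\<Sum>k\<in>UNIV. \<Sum>l\<in>UNIV. x $ i $ k * y $ l $ j * v $ k $ l)"
      by (subst sum.swap) (simp add: sum_distrib_left sum_distrib_right mult_ac)
    then show ?thesis by (simp add: sum.cartesian_product case_prod_unfold)
  qed
  then show ?thesis
    by (simp add: vec_eq_iff hs_def act_def kron_def matrix_matrix_mult_def matrix_vector_mult_def)
qed

lemma subspace_hs_iff: "vec.subspace (hs ` V) \<longleftrightarrow> mat.subspace V"
proof -
  have mem: "hs x \<in> hs ` V \<longleftrightarrow> x \<in> V" for x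
    by (rule inj_image_mem_iff[OF bij_is_inj[OF bij_hs]])
  show ?thesis
    unfolding vec.subspace_def mat.subspace_def
    by (simp only: ball_simps mem flip: hs_0 hs_add hs_cscale)
qed

text \<open>Elementary tensors act as two-sided multiplications by \<open>hs_mult\<close>; because
  \<open>V\<close> is a subspace, invariance under them extends to their span.\<close>

lemma act_invariant_hs_iff:
  fixes V :: "(complex^'n^'n) set"
  assumes V: "mat.subspace V"
  shows "(\<forall>x\<in>tensor_alg C C. \<forall>v\<in>hs ` V. act x *v v \<in> hs ` V) \<longleftrightarrow>
    (\<forall>x\<in>C. \<forall>y\<in>C. \<forall>v\<in>V. x ** v ** y \<in> V)"
proof
  assume L: "\<forall>x\<in>tensor_alg C C. \<forall>v\<in>hs ` V. act x *v v \<in> hs ` V"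
  show "\<forall>x\<in>C. \<forall>y\<in>C. \<forall>v\<in>V. x ** v ** y \<in> V"
  proof (intro ballI)
    fix x y v assume "x \<in> C" "y \<in> C" "v \<in> V"
    then have "hs (x ** v ** y) \<in> hs ` V"
      using L by (simp add: hs_mult kron_in_tensor_alg)
    then show "x ** v ** y \<in> V"
      by (simp only: inj_image_mem_iff[OF bij_is_inj[OF bij_hs]])
  qed
next
  assume R: "\<forall>x\<in>C. \<forall>y\<in>C. \<forall>v\<in>V. x ** v ** y \<in> V"
  have sub: "vec.subspace (hs ` V)" using V by (simp add: subspace_hs_iff)
  show "\<forall>x\<in>tensor_alg C C. \<forall>v\<in>hs ` V. act x *v v \<in> hs ` V"
  proof (intro ballI)
    fix x w assume x: "x \<in> tensor_alg C C" and "w \<in> hs ` V"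
    then obtain v where v: "v \<in> V" "w = hs v" by blast
    have sc: "cscale c z *v u = c *s (z *v u)" for c u and z :: "complex^('n \<times> 'n)^('n \<times> 'n)"
      by (simp add: vec_eq_iff cscale_def matrix_vector_mult_def sum_distrib_left mult.assoc)
    show "act x *v w \<in> hs ` V"
      using x
    proof (induction rule: tensor_alg_induct)
      case zero
      show ?case using vec.subspace_0[OF sub] by simp
    next
      case (step c a b y)
      have "act (kron a b) *v w = hs (a ** v ** b)" using v by (simp add: hs_mult)
      then have "act (kron a b) *v w \<in> hs ` V" using R v step(1,2) by simp
      then show ?case
        using step(3) sub
        by (simp add: act_add act_cscale sc matrix_vector_mult_add_rdistrib vec.subspace_add vec.subspace_scale)
    qed
  qed
qed

lemma hs_decomps_iff:
  fixes V W :: "(complex^'n^'n) set"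
  shows "(hs ` V, hs ` W) \<in> invariant_decomps B \<longleftrightarrow> (V, W) \<in> bimodule_decomps B"
proof -
  note inj = bij_is_inj[OF bij_hs] and surj = bij_is_surj[OF bij_hs]
  have Int: "hs ` V \<inter> hs ` W = {0} \<longleftrightarrow> V \<inter> W = {0}"
    using inj_image_eq_iff[OF inj, of "V \<inter> W" "{0}"] by (simp add: image_Int[OF inj])
  have sum: "{v + w |v w. v \<in> hs ` V \<and> w \<in> hs ` W} = UNIV \<longleftrightarrow> {v + w |v w. v \<in> V \<and> w \<in> W} = UNIV"
  proof -
    have "{v + w |v w. v \<in> hs ` V \<and> w \<in> hs ` W} = hs ` {v + w |v w. v \<in> V \<and> w \<in> W}"
      by (force simp: hs_add)
    moreover have "hs ` S = UNIV \<longleftrightarrow> S = UNIV" for S :: "(complex^'n^'n) set"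
      using inj_image_eq_iff[OF inj, of S UNIV] by (simp add: surj)
    ultimately show ?thesis by simp
  qed
  have adj: "J0 ` hs ` S = hs ` S \<longleftrightarrow> adj ` S = S" for S :: "(complex^'n^'n) set"
    using inj_image_eq_iff[OF inj, of "adj ` S" S] by (simp add: image_image hs_adj)
  show ?thesis
    unfolding invariant_decomps_def bimodule_decomps_def bimodule_def mem_Collect_eq case_prod_conv
      subspace_hs_iff Int sum adj ball_conj_distrib
    using act_invariant_hs_iff[of V "commutant B"] act_invariant_hs_iff[of W "commutant B"]
    by argo
qed

lemma bij_betw_hs:
  "bij_betw (\<lambda>(V, W). (hs ` V, hs ` W)) (bimodule_decomps B) (invariant_decomps B)"
  unfolding bij_betw_def
proof (intro conjI subset_antisym subsetI)
  show "inj_on (\<lambda>(V, W). (hs ` V, hs ` W)) (bimodule_decomps B)"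
    by (rule inj_onI) (auto simp: inj_image_eq_iff[OF bij_is_inj[OF bij_hs]])
next
  fix VW assume "VW \<in> (\<lambda>(V, W). (hs ` V, hs ` W)) ` bimodule_decomps B"
  then show "VW \<in> invariant_decomps B" by (auto simp: hs_decomps_iff)
next
  fix VW assume VW: "VW \<in> invariant_decomps B"
  obtain V W where eq: "VW = (hs ` V, hs ` W)"
    using bij_is_surj[OF bij_hs] by (metis surj_pair surj_image_vimage_eq)
  with VW show "VW \<in> (\<lambda>(V, W). (hs ` V, hs ` W)) ` bimodule_decomps B"
    by (force simp: hs_decomps_iff)
qed

section \<open>The modular group\<close>

text \<open>The universal property of the tensor product in coordinates. It makes the definite
  description in \<open>gns_mult\<close> meaningful.\<close>

lemma ex1_matrix_vtensor:
  fixes b :: "complex^'k \<Rightarrow> complex^'l \<Rightarrow> complex^'m"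
  assumes left: "\<And>x y z. b (x + y) z = b x z + b y z" "\<And>c x z. b (c *s x) z = c *s b x z"
    and right: "\<And>x y z. b z (x + y) = b z x + b z y" "\<And>c x z. b z (c *s x) = c *s b z x"
  shows "\<exists>!m. \<forall>\<xi> \<eta>. m *v vtensor \<xi> \<eta> = b \<xi> \<eta>"
proof (rule ex1I)
  have zero: "b 0 z = 0" "b z' 0 = 0" for z z'
    using left(1)[of 0 0 z] right(1)[of z' 0 0] by simp_all
  have "b (\<Sum>i\<in>I. \<xi> $ i *s axis i 1) \<eta> = (\<Sum>i\<in>I. \<xi> $ i *s b (axis i 1) \<eta>)" for I \<xi> \<eta>
    by (induction I rule: infinite_finite_induct) (simp_all add: left zero)
  then have bl: "b \<xi> \<eta> = (\<Sum>i\<in>UNIV. \<xi> $ i *s b (axis i 1) \<eta>)" for \<xi> \<eta>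
    by (metis basis_expansion)
  have "b \<xi> (\<Sum>i\<in>I. \<eta> $ i *s axis i 1) = (\<Sum>i\<in>I. \<eta> $ i *s b \<xi> (axis i 1))" for I \<xi> \<eta>
    by (induction I rule: infinite_finite_induct) (simp_all add: right zero)
  then have br: "b \<xi> \<eta> = (\<Sum>i\<in>UNIV. \<eta> $ i *s b \<xi> (axis i 1))" for \<xi> \<eta>
    by (metis basis_expansion)
  have expand: "b \<xi> \<eta> = (\<Sum>i\<in>UNIV. \<xi> $ i *s (\<Sum>j\<in>UNIV. \<eta> $ j *s b (axis i 1) (axis j 1)))" for \<xi> \<eta>
    by (subst bl, subst br) (rule refl)
  let ?m = "\<chi> k p. b (axis (fst p) 1) (axis (snd p) 1) $ k"
  show "\<forall>\<xi> \<eta>. ?m *v vtensor \<xi> \<eta> = b \<xi> \<eta>"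
  proof (intro allI)
    fix \<xi> \<eta>
    have "(\<Sum>p\<in>UNIV. b (axis (fst p) 1) (axis (snd p) 1) $ k * (\<xi> $ fst p * \<eta> $ snd p))
        = (\<Sum>i\<in>UNIV. \<Sum>j\<in>UNIV. b (axis i 1) (axis j 1) $ k * (\<xi> $ i * \<eta> $ j))" for k
      by (simp add: sum.cartesian_product case_prod_unfold)
    then show "?m *v vtensor \<xi> \<eta> = b \<xi> \<eta>"
      unfolding expand[of \<xi> \<eta>]
      by (simp add: vec_eq_iff matrix_vector_mult_def vtensor_def sum_distrib_left mult_ac)
  qed
  fix m assume m: "\<forall>\<xi> \<eta>. m *v vtensor \<xi> \<eta> = b \<xi> \<eta>"
  have "m $ k $ p = b (axis (fst p) 1) (axis (snd p) 1) $ k" for k p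
  proof -
    have "vtensor (axis (fst p) 1) (axis (snd p) 1) = axis p 1"
      by (auto simp: vec_eq_iff vtensor_def axis_def prod_eq_iff)
    then have "b (axis (fst p) 1) (axis (snd p) 1) = m *v axis p 1" using m by metis
    then show ?thesis by (simp add: matrix_vector_mult_def axis_def if_distrib[of "\<lambda>z. _ * z"] cong: if_cong)
  qed
  then show "m = ?m" by (simp add: vec_eq_iff)
qed

text \<open>Conjugation by an invertible element that lies in \<open>B\<close> because the complex
  powers of \<open>Q\<close> do. Nothing is claimed about adjoints: at \<open>\<i> * t\<close> it is
  conjugation by a real power of \<open>Q\<close>, which need not preserve them.\<close>

lemma modular_star_automorphism:
  assumes B: "star_subalgebra B" and Q: "Q \<in> B" "positive_mat Q" "invertible Q"
  shows "modular Q z (a ** b) = modular Q z a ** modular Q z b"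
    and "a \<in> B \<Longrightarrow> modular Q z a \<in> B" and "modular Q (- z) (modular Q z a) = a"
proof -
  let ?w = "\<i> * z"
  have inv: "cpow Q ?w ** cpow Q (- ?w) = mat 1" "cpow Q (- ?w) ** cpow Q ?w = mat 1"
    using cpow_minus[OF Q(2,3), of ?w] cpow_minus[OF Q(2,3), of "- ?w"] by simp_all
  have "modular Q z a ** modular Q z b =
      cpow Q ?w ** a ** (cpow Q (- ?w) ** cpow Q ?w) ** b ** cpow Q (- ?w)"
    by (simp only: modular_def matrix_mul_assoc)
  then show "modular Q z (a ** b) = modular Q z a ** modular Q z b"
    by (simp add: inv modular_def matrix_mul_assoc)
  show "modular Q z a \<in> B" if "a \<in> B"
    unfolding modular_def
    by (intro star_subalgebraD(4)[OF B] cpow_in_star_subalgebra[OF B Q] that)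
  have "modular Q (- z) (modular Q z a) =
      (cpow Q (- ?w) ** cpow Q ?w) ** a ** (cpow Q (- ?w) ** cpow Q ?w)"
    by (simp add: modular_def matrix_mul_assoc)
  then show "modular Q (- z) (modular Q z a) = a" by (simp add: inv)
qed

lemma modular_linear:
  "modular Q z (a + b) = modular Q z a + modular Q z b"
  "modular Q z (cscale c a) = cscale c (modular Q z a)"
  by (simp_all add: modular_def mat_mult_cscale_left mat_mult_cscale_right mat_mult_add_left matrix_add_ldistrib)

section \<open>The bijection from adjacency operators, for both choices of \<Phi>\<close>

theorem theorem5p14:
  fixes B :: "(complex^'n^'n) set"
    and blk :: "'m::finite \<Rightarrow> nat"
    and \<phi> :: "complex^'n^'n \<Rightarrow> complex^'m^'m"
    and \<psi> :: "complex^'n^'n \<Rightarrow> complex"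
    and Q :: "complex^'n^'n"
    and \<Lambda> :: "complex^'n^'n \<Rightarrow> complex^'d"
    and t :: real
    and \<Phi> :: "complex^'d^'d \<Rightarrow> complex^('n \<times> 'n)^('n \<times> 'n)"
  assumes B: "star_subalgebra B"
    and blocks: "star_iso \<phi> B (block_diagonal blk)"
    and state: "faithful_state B \<psi>"
    and Q: "Q \<in> B" "positive_mat Q" "invertible Q" "\<forall>a\<in>B. \<psi> a = trace (\<phi> (Q ** a))"
    and gns: "gns_map B \<psi> \<Lambda>"
    and Phi: "\<Phi> = Psi B Q \<Lambda> t t \<or> \<Phi> = Psi' B Q \<Lambda> t t"
  shows "bij_betw \<Phi> (adjacency_ops B \<Lambda>) (swap_idempotents B) \<and>
    bij_betw im_ker (swap_idempotents B) (invariant_decomps B) \<and>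
    bij_betw (\<lambda>(V, W). (hs ` V, hs ` W)) (bimodule_decomps B) (invariant_decomps B)"
proof (intro conjI bij_betw_im_ker[OF B] bij_betw_hs)
  have bij: "bij_betw \<Lambda> B UNIV"
    and \<Lambda>_add: "\<And>a b. a \<in> B \<Longrightarrow> b \<in> B \<Longrightarrow> \<Lambda> (a + b) = \<Lambda> a + \<Lambda> b"
    and \<Lambda>_scale: "\<And>c a. a \<in> B \<Longrightarrow> \<Lambda> (cscale c a) = c *s \<Lambda> a"
    using gns by (auto simp: gns_map_def)
  define L where "L = inv_into B \<Lambda>"
  have L: "\<Lambda> (L \<xi>) = \<xi>" "L \<xi> \<in> B" for \<xi>
    using bij by (auto simp: L_def bij_betw_def f_inv_into_f inv_into_into)
  have L': "L (\<Lambda> a) = a" if "a \<in> B" for a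
    using bij that by (simp add: L_def bij_betw_inv_into_left)
  note Bcl = star_subalgebraD[OF B]
  have L_add: "L (\<xi> + \<eta>) = L \<xi> + L \<eta>" for \<xi> \<eta>
    using L'[of "L \<xi> + L \<eta>"] by (simp add: \<Lambda>_add L Bcl)
  have L_scale: "L (c *s \<xi>) = cscale c (L \<xi>)" for c \<xi>
    using L'[of "cscale c (L \<xi>)"] by (simp add: \<Lambda>_scale L Bcl)
  let ?\<sigma> = "modular Q (\<i> * of_real t)"
  note \<sigma> = modular_star_automorphism[OF B Q(1-3), where z = "\<i> * of_real t"]
  have \<sigma>': "?\<sigma> (modular Q (- (\<i> * of_real t)) a) = a" for a
    using modular_star_automorphism(3)[OF B Q(1-3), of "- (\<i> * of_real t)" a] by simp
  \<comment> \<open>The modular automorphism read on GNS vectors; transporting it to the GNS space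
    lets \<open>Psi\<close> become a \<open>theta_rep\<close>.\<close>
  define s where "s = (\<lambda>\<xi>. ?\<sigma> (L \<xi>))"
  interpret linear_into_matrices s
    by unfold_locales (simp_all add: s_def L_add L_scale modular_linear)
  have s\<Lambda>: "s (\<Lambda> a) = ?\<sigma> a" if "a \<in> B" for a
    by (simp add: s_def L' that)
  have inj_s: "inj s"
    by (rule inj_on_inverseI[where g = "\<lambda>x. \<Lambda> (modular Q (- (\<i> * of_real t)) x)"])
      (simp add: s_def \<sigma>(3) L)
  have range_s: "range s = B"
  proof (intro subset_antisym subsetI)
    fix x assume "x \<in> B"
    then have "modular Q (- (\<i> * of_real t)) x \<in> B"
      by (rule modular_star_automorphism(2)[OF B Q(1-3)])
    then have "x = s (\<Lambda> (modular Q (- (\<i> * of_real t)) x))"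
      by (simp add: s\<Lambda> \<sigma>')
    then show "x \<in> range s" by (rule range_eqI)
  qed (auto simp: s_def L \<sigma>(2))
  define m where "m = gns_mult B \<Lambda>"
  have m: "m *v vtensor \<xi> \<eta> = \<Lambda> (L \<xi> ** L \<eta>)" for \<xi> \<eta>
  proof -
    have "\<exists>!m. \<forall>\<xi> \<eta>. m *v vtensor \<xi> \<eta> = \<Lambda> (L \<xi> ** L \<eta>)"
      by (rule ex1_matrix_vtensor)
        (simp_all add: L_add L_scale mat_mult_add_left matrix_add_ldistrib mat_mult_cscale_left
          mat_mult_cscale_right \<Lambda>_add \<Lambda>_scale L Bcl)
    moreover have "(\<forall>\<xi> \<eta>. m *v vtensor \<xi> \<eta> = \<Lambda> (L \<xi> ** L \<eta>)) \<longleftrightarrow>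
        (\<forall>a\<in>B. \<forall>b\<in>B. m *v vtensor (\<Lambda> a) (\<Lambda> b) = \<Lambda> (a ** b))" for m
      by (metis L L')
    ultimately have "\<exists>!m. \<forall>a\<in>B. \<forall>b\<in>B. m *v vtensor (\<Lambda> a) (\<Lambda> b) = \<Lambda> (a ** b)"
      by simp
    from theI'[OF this] have "m *v vtensor (\<Lambda> a) (\<Lambda> b) = \<Lambda> (a ** b)" if "a \<in> B" "b \<in> B" for a b
      using that by (simp add: m_def gns_mult_def)
    from this[of "L \<xi>" "L \<eta>"] show ?thesis by (simp add: L)
  qed
  \<comment> \<open>Multiplicativity of the automorphism on \<open>B\<close>, combined with the
    description of \<open>m\<close> as the product of \<open>B\<close>.\<close>
  have s_m: "s (m *v vtensor \<xi> \<eta>) = s \<xi> ** s \<eta>" for \<xi> \<eta>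
    by (simp add: m s\<Lambda> Bcl L \<sigma>(1)) (simp add: s_def)
  have theta_eq: "F = theta_rep s"
    if "Vector_Spaces.linear cscale cscale F"
      "\<And>a b. a \<in> B \<Longrightarrow> b \<in> B \<Longrightarrow> F (theta (\<Lambda> a) (\<Lambda> b)) = kron (adj (?\<sigma> a)) (?\<sigma> b)" for F
  proof (rule theta_rep_unique[OF that(1)])
    show "F (theta \<xi> \<eta>) = kron (adj (s \<xi>)) (s \<eta>)" for \<xi> \<eta>
      using that(2)[of "L \<xi>" "L \<eta>"] by (simp add: L s_def)
  qed
  have Psi: "Psi B Q \<Lambda> t t = theta_rep s"
    unfolding Psi_def
    by (rule the_equality) (auto simp: linear_theta_rep theta_rep_theta s\<Lambda> intro!: theta_eq)
  have linear_swap: "Vector_Spaces.linear cscale cscale (\<lambda>X. swap (F X))"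
    if "Vector_Spaces.linear cscale cscale F"
    for F :: "complex^'d^'d \<Rightarrow> complex^('n \<times> 'n)^('n \<times> 'n)"
    using that by (simp add: Vector_Spaces.linear_iff swap_add swap_cscale)
  have Psi': "Psi' B Q \<Lambda> t t = swap \<circ> theta_rep s"
    unfolding Psi'_def
  proof (rule the_equality)
    show "Vector_Spaces.linear cscale cscale (swap \<circ> theta_rep s) \<and>
        (\<forall>a\<in>B. \<forall>b\<in>B. (swap \<circ> theta_rep s) (theta (\<Lambda> a) (\<Lambda> b)) = kron (?\<sigma> b) (adj (?\<sigma> a)))"
      using linear_swap[OF linear_theta_rep] by (simp add: o_def theta_rep_theta s\<Lambda> swap_kron)
    fix F assume F: "Vector_Spaces.linear cscale cscale F \<and>
        (\<forall>a\<in>B. \<forall>b\<in>B. F (theta (\<Lambda> a) (\<Lambda> b)) = kron (?\<sigma> b) (adj (?\<sigma> a)))"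
    then have "(\<lambda>X. swap (F X)) = theta_rep s"
      by (intro theta_eq linear_swap) (auto simp: swap_kron)
    then show "F = swap \<circ> theta_rep s" by (simp add: fun_eq_iff) (metis swap_swap)
  qed
  have "bij_betw (theta_rep s) (adjacency_ops B \<Lambda>) (swap_idempotents B)"
  proof -
    \<comment> \<open>Since \<open>theta_rep s\<close> is injective, idempotency and flip-invariance
      of the image each reflect back to one defining equation of \<open>A\<close>; membership in the
      tensor product is automatic.\<close>
    have iff: "theta_rep s A \<in> swap_idempotents B \<longleftrightarrow> A \<in> adjacency_ops B \<Lambda>" for A
    proof -
      have "theta_rep s A \<in> tensor_alg B B"
        using range_theta_rep[OF B range_s] by blast
      moreover have "op_mult (theta_rep s A) (theta_rep s A) = theta_rep s A \<longleftrightarrow> m ** kron A A ** adj m = A"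
        using inj_theta_rep[OF inj_s] by (simp add: inj_eq flip: theta_rep_schur_product[OF s_m])
      moreover have "theta_rep s A = swap (adj (theta_rep s A)) \<longleftrightarrow> adj A = A"
        using inj_theta_rep[OF inj_s] by (auto simp: inj_eq simp flip: theta_rep_adj)
      ultimately show ?thesis
        by (auto simp: swap_idempotents_def adjacency_ops_def m_def)
    qed
    have "swap_idempotents B \<subseteq> range (theta_rep s)"
      using range_theta_rep[OF B range_s] by (auto simp: swap_idempotents_def)
    then show ?thesis
      using inj_theta_rep[OF inj_s] iff by (auto simp: bij_betw_def inj_on_def)
  qed
  then show "bij_betw \<Phi> (adjacency_ops B \<Lambda>) (swap_idempotents B)"
    using Phi Psi Psi' bij_betw_trans[OF _ bij_betw_swap] by metis
qed

end
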